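(* Let $\mathbb F$ be a field of characteristic $0$, let $p\ge2$ be a fixed integer, let $r$ be a constant, and let $G=(V,E)$ be a connected undirected $r$-regular graph with $n$ vertices and no double edges, with $n\equiv1\pmod p$. Then there are depth-3 fMC refutations over $\mathbb F$ of $\neg\mathrm{TSEITIN}_{G,p}$ of size polynomial in $n$.
   Context: Let $G'=(V,E')$ replace each edge of $G$ by two opposite directed edges; $e[v,1],\dots,e[v,r]$ are the edges leaving $v$. Variables $x_{e,i}$, $e\in E'$, $i\in\{0,\dots,p-1\}$. $\neg\mathrm{TSEITIN}_{G,p}$ consists of the disjunctions of linear equations: (1) $\bigvee_{i=0}^{p-1}(x_{e,i}=1)$, $e\in E'$; (2) $(x_{e,i}=0)\vee(x_{e,j}=0)$, $i\ne j$; (3) $(x_{e,i}=1)\vee(x_{\bar e,p-i}=0)$ and $(x_{e,i}=0)\vee(x_{\bar e,p-i}=1)$ for opposite pairs $e,\bar e$ and all $i$ ($x_{\bar e,p}$ means $x_{\bar e,0}$); (4) for each $v$, $\bigvee_{k=1}^r(x_{e[v,k],i_k}=0)$ for all $i_1,\dots,i_r$ with $\sum i_k\not\equiv1\pmod p$. A disjunction $D=\bigvee_{j}(\vec a^{(j)}\cdot\vec x=a^{(j)}_0)$ is translated to $\widehat D=\prod_j(\vec a^{(j)}\cdot\vec x-a^{(j)}_0)$; an fMC refutation of the formula is one of the translated polynomials. Arithmetic formula: tree, unbounded fan-in, leaves variables or field elements, edges possibly labeled by field elements, internal nodes $+,\times$; size = number of nodes; depth = longest leaf-to-root path. Multilinear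 formula: every gate computes a multilinear polynomial. fMC: variables $x_i,\bar x_i$; Boolean axioms $x_i+\bar x_i-1$, $x_i\bar x_i$; lines are multilinear polynomials each initial, a Boolean axiom, or derived by Product (from $p$ derive $qp$ with $qp$ multilinear) or Addition ($\alpha p+\beta q$); represented by multilinear formulas; size = total formula size; refutation derives $1$. Depth-3 fMC: all formulas of depth at most 3. *)

theory Defs
  imports
    Complex_Main
    "HOL-Library.Poly_Mapping"
    "HOL-Computational_Algebra.Polynomial"
    "HOL-Number_Theory.Cong"
begin

section \<open>Multivariate polynomials\<close>

text \<open>A monomial is a finitely supported exponent vector, a polynomial a finitely supported map
  from monomials to coefficients; addition and multiplication are the library's.\<close>

type_synonym ('y, 'a) mpoly = "('y \<Rightarrow>\<^sub>0 nat) \<Rightarrow>\<^sub>0 'a"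

definition mconst :: "'a::comm_ring_1 \<Rightarrow> ('y, 'a) mpoly" where
  "mconst c = Poly_Mapping.single 0 c"

definition mvar :: "'y \<Rightarrow> ('y, 'a::comm_ring_1) mpoly" where
  "mvar y = Poly_Mapping.single (Poly_Mapping.single y 1) 1"

definition mpoly_vars :: "('y, 'a::comm_ring_1) mpoly \<Rightarrow> 'y set" where
  "mpoly_vars P = (\<Union>m\<in>Poly_Mapping.keys P. Poly_Mapping.keys m)"

definition multilinear :: "('y, 'a::comm_ring_1) mpoly \<Rightarrow> bool" where
  "multilinear P \<longleftrightarrow> (\<forall>m\<in>Poly_Mapping.keys P. \<forall>y. Poly_Mapping.lookup m y \<le> 1)"


section \<open>Arithmetic formulas\<close>

text \<open>Each child of a gate comes with the label of the edge leading to it. The label multiplies the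
  polynomial computed at the child; an unlabeled edge is an edge with label \<open>1\<close>.\<close>

datatype gate = Plus | Times

datatype ('y, 'a) formula =
    Var 'y
  | Scalar 'a
  | Gate gate "('a \<times> ('y, 'a) formula) list"

fun computes :: "('y, 'a::comm_ring_1) formula \<Rightarrow> ('y, 'a) mpoly" where
  "computes (Var y) = mvar y"
| "computes (Scalar c) = mconst c"
| "computes (Gate Plus Fs) = sum_list (map (\<lambda>(c, F). mconst c * computes F) Fs)"
| "computes (Gate Times Fs) = prod_list (map (\<lambda>(c, F). mconst c * computes F) Fs)"

fun nodes :: "('y, 'a) formula \<Rightarrow> nat" where
  "nodes (Var y) = 1"
| "nodes (Scalar c) = 1"
| "nodes (Gate g Fs) = 1 + sum_list (map (\<lambda>(c, F). nodes F) Fs)"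

fun depth :: "('y, 'a) formula \<Rightarrow> nat" where
  "depth (Var y) = 0"
| "depth (Scalar c) = 0"
| "depth (Gate g Fs) = 1 + Max (insert 0 ((\<lambda>(c, F). depth F) ` set Fs))"

fun subformulas :: "('y, 'a) formula \<Rightarrow> ('y, 'a) formula set" where
  "subformulas (Var y) = {Var y}"
| "subformulas (Scalar c) = {Scalar c}"
| "subformulas (Gate g Fs) = insert (Gate g Fs) (\<Union>(c, F)\<in>set Fs. subformulas F)"

definition formula_vars :: "('y, 'a) formula \<Rightarrow> 'y set" where
  "formula_vars F = {y. Var y \<in> subformulas F}"

text \<open>Nodes of fan-in 0 are leaves, so a gate has at least one child. The datatype does not enforce
  this.\<close>

definition arithmetic_formula :: "('y, 'a) formula \<Rightarrow> bool" where
  "arithmetic_formula F \<longleftrightarrow> (\<forall>g. Gate g [] \<notin> subformulas F)"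

definition multilinear_formula :: "('y, 'a::comm_ring_1) formula \<Rightarrow> bool" where
  "multilinear_formula F \<longleftrightarrow>
     arithmetic_formula F \<and> (\<forall>H\<in>subformulas F. multilinear (computes H))"


section \<open>Formula Multilinear Calculus\<close>

text \<open>\<open>Pos x\<close> is the variable $x$, and \<open>Neg x\<close> is the variable $\bar x$.\<close>

datatype 'x fmc_var = Pos 'x | Neg 'x

definition fmc_vars :: "'x set \<Rightarrow> 'x fmc_var set" where
  "fmc_vars X = Pos ` X \<union> Neg ` X"

definition boolean_axioms :: "'x set \<Rightarrow> ('x fmc_var, 'a::comm_ring_1) mpoly set" where
  "boolean_axioms X =
     (\<Union>x\<in>X. {mvar (Pos x) + mvar (Neg x) - 1, mvar (Pos x) * mvar (Neg x)})"

text \<open>A proof over the variables \<open>X\<close> from the initial polynomials \<open>Q\<close> is a list of formulas; the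
  derivation rules speak about the polynomials they compute. The side condition of the product
  rule, that the derived polynomial be multilinear, is subsumed by \<open>multilinear_formula\<close>.\<close>

definition fmc_proof ::
    "'x set \<Rightarrow> ('x fmc_var, 'a::comm_ring_1) mpoly set \<Rightarrow> ('x fmc_var, 'a) formula list \<Rightarrow> bool" where
  "fmc_proof X Q \<pi> \<longleftrightarrow> (\<forall>i<length \<pi>.
     multilinear_formula (\<pi> ! i) \<and> formula_vars (\<pi> ! i) \<subseteq> fmc_vars X \<and>
     (computes (\<pi> ! i) \<in> Q \<or>
      computes (\<pi> ! i) \<in> boolean_axioms X \<or>
      (\<exists>j<i. \<exists>q. mpoly_vars q \<subseteq> fmc_vars X \<and> computes (\<pi> ! i) = q * computes (\<pi> ! j)) \<or>
      (\<exists>j<i. \<exists>k<i. \<exists>\<alpha> \<beta>. computes (\<pi> ! i) =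
         mconst \<alpha> * computes (\<pi> ! j) + mconst \<beta> * computes (\<pi> ! k))))"

definition fmc_refutation ::
    "'x set \<Rightarrow> ('x fmc_var, 'a::comm_ring_1) mpoly set \<Rightarrow> ('x fmc_var, 'a) formula list \<Rightarrow> bool" where
  "fmc_refutation X Q \<pi> \<longleftrightarrow> fmc_proof X Q \<pi> \<and> \<pi> \<noteq> [] \<and> computes (last \<pi>) = 1"

definition depth_fmc_refutation ::
    "nat \<Rightarrow> 'x set \<Rightarrow> ('x fmc_var, 'a::comm_ring_1) mpoly set \<Rightarrow> ('x fmc_var, 'a) formula list \<Rightarrow> bool"
  where
  "depth_fmc_refutation d X Q \<pi> \<longleftrightarrow> fmc_refutation X Q \<pi> \<and> (\<forall>F\<in>set \<pi>. depth F \<le> d)"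

definition proof_size :: "('y, 'a) formula list \<Rightarrow> nat" where
  "proof_size \<pi> = sum_list (map nodes \<pi>)"


section \<open>Disjunctions of linear equations\<close>

text \<open>The pair \<open>(a, a\<^sub>0)\<close> is the equation $\vec a\cdot\vec x = a_0$, with \<open>a\<close> the finitely supported
  coefficient vector; a disjunction is the list of its disjuncts.\<close>

type_synonym ('x, 'a) lin_eq = "('x \<Rightarrow>\<^sub>0 'a) \<times> 'a"

type_synonym ('x, 'a) disjunction = "('x, 'a) lin_eq list"

definition var_eq :: "'x \<Rightarrow> 'a \<Rightarrow> ('x, 'a::comm_ring_1) lin_eq" where
  "var_eq x c = (Poly_Mapping.single x 1, c)"

definition translate_eq :: "('x, 'a::comm_ring_1) lin_eq \<Rightarrow> ('x fmc_var, 'a) mpoly" where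
  "translate_eq = (\<lambda>(a, a\<^sub>0).
     (\<Sum>x\<in>Poly_Mapping.keys a. mconst (Poly_Mapping.lookup a x) * mvar (Pos x)) - mconst a\<^sub>0)"

definition translate :: "('x, 'a::comm_ring_1) disjunction \<Rightarrow> ('x fmc_var, 'a) mpoly" where
  "translate D = prod_list (map translate_eq D)"


section \<open>Graphs and the Tseitin formulas\<close>

definition simple_graph :: "'v set \<Rightarrow> 'v set set \<Rightarrow> bool" where
  "simple_graph V E \<longleftrightarrow> finite V \<and> (\<forall>e\<in>E. \<exists>u\<in>V. \<exists>v\<in>V. u \<noteq> v \<and> e = {u, v})"

definition regular_graph :: "'v set \<Rightarrow> 'v set set \<Rightarrow> nat \<Rightarrow> bool" where
  "regular_graph V E r \<longleftrightarrow> (\<forall>v\<in>V. card {e\<in>E. v \<in> e} = r)"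

text \<open>The edge set $E'$ of the directed graph $G'$; the directed edge from \<open>u\<close> to \<open>v\<close> is \<open>(u, v)\<close>.\<close>

definition directed_edges :: "'v set set \<Rightarrow> ('v \<times> 'v) set" where
  "directed_edges E = {(u, v). {u, v} \<in> E}"

definition connected_graph :: "'v set \<Rightarrow> 'v set set \<Rightarrow> bool" where
  "connected_graph V E \<longleftrightarrow> (\<forall>u\<in>V. \<forall>v\<in>V. (u, v) \<in> (directed_edges E)\<^sup>*)"

text \<open>\<open>out v 1, \<dots>, out v r\<close> enumerates the directed edges leaving \<open>v\<close>.\<close>

definition out_enumeration ::
    "'v set \<Rightarrow> 'v set set \<Rightarrow> nat \<Rightarrow> ('v \<Rightarrow> nat \<Rightarrow> 'v \<times> 'v) \<Rightarrow> bool" where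
  "out_enumeration V E r out \<longleftrightarrow>
     (\<forall>v\<in>V. bij_betw (out v) {1..r} {e \<in> directed_edges E. fst e = v})"

text \<open>The variable $x_{e,i}$ is the pair \<open>(e, i)\<close>.\<close>

type_synonym 'v tseitin_var = "('v \<times> 'v) \<times> nat"

definition tseitin_vars :: "'v set set \<Rightarrow> nat \<Rightarrow> 'v tseitin_var set" where
  "tseitin_vars E p = directed_edges E \<times> {0..<p}"

definition neg_tseitin ::
    "'v set \<Rightarrow> 'v set set \<Rightarrow> nat \<Rightarrow> nat \<Rightarrow> ('v \<Rightarrow> nat \<Rightarrow> 'v \<times> 'v) \<Rightarrow>
     ('v tseitin_var, 'a::comm_ring_1) disjunction set" where
  "neg_tseitin V E p r out =
     {map (\<lambda>i. var_eq (e, i) 1) [0..<p] |e. e \<in> directed_edges E}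
   \<union> {[var_eq (e, i) 0, var_eq (e, j) 0] |e i j.
        e \<in> directed_edges E \<and> i < p \<and> j < p \<and> i \<noteq> j}
   \<union> {[var_eq ((u, v), i) 1, var_eq ((v, u), (p - i) mod p) 0] |u v i.
        (u, v) \<in> directed_edges E \<and> i < p}
   \<union> {[var_eq ((u, v), i) 0, var_eq ((v, u), (p - i) mod p) 1] |u v i.
        (u, v) \<in> directed_edges E \<and> i < p}
   \<union> {map (\<lambda>k. var_eq (out v k, i k) 0) [1..<Suc r] |v i.
        v \<in> V \<and> (\<forall>k\<in>{1..r}. i k < p) \<and> \<not> [(\<Sum>k=1..r. i k) = 1] (mod p)}"

end

theory Submission
  imports Defs "HOL-Library.FuncSet"
begin

text \<open>For a set \<open>A\<close> of directed edges and a residue \<open>s\<close>, let \<open>f A s\<close> be the sum, over all assignments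
  of values to the edges in \<open>A\<close> with total \<open>s\<close> modulo \<open>p\<close>, of the corresponding products of variables.
  It is a sum of coefficients of a product of one affine form per edge, so interpolation in
  characteristic 0 makes it a short sum of products of affine forms. Start from \<open>f (\<delta> v) s = 0\<close> for
  \<open>s \<noteq> 1\<close>, where \<open>\<delta> v\<close> are the edges leaving \<open>v\<close>. Convolution over the vertices gives
  \<open>f E' s = 0\<close> for \<open>s \<noteq> n\<close>. A pair of opposite edges contributes 0 to the total, hence can be removed
  from the set; when all are removed, \<open>f {} 0 = 1\<close> is derived, since \<open>0 \<noteq> n\<close> modulo \<open>p\<close>.\<close>

section \<open>Multivariate polynomials\<close>

text \<open>The obstacle is that every line must be multilinear and have a small formula of depth 3.
  Hence a flow is only ever multiplied by factors over other variables: a flow over a disjoint edge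
  set, or variables of an edge pair outside its set. Nothing accumulates along the derivation,
  because the rules speak about polynomials and not about formulas. A convolution is built as a sum
  of products of two flows, with a number of summands quadratic in the size of one flow; as a
  polynomial it is itself the flow of the union and as such has a short representation again. Only
  the residues \<open>s\<close> that differ from the expected total are tracked. This family of
  vanishing flows is closed under convolution: if the two totals do not add up to the expected one,
  at least one of them is already wrong. A vertex or an edge pair costs a number of lines that
  depends only on \<open>p\<close> and \<open>r\<close>, so the number of lines is linear in the
  number of vertices.\<close>

lemma mconst_0 [simp]: "mconst 0 = 0"
  by (simp add: mconst_def)

lemma mconst_1 [simp]: "mconst 1 = 1"
  by (simp add: mconst_def)

lemma mconst_add: "mconst (a + b) = mconst a + mconst b"
  by (simp add: mconst_def single_add)

lemma mconst_minus: "mconst (- a) = - mconst a"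
  by (simp add: mconst_def single_uminus)

lemma mconst_mult: "mconst (a * b) = mconst a * mconst b"
  by (simp add: mconst_def mult_single)

lemma mconst_power: "mconst (a ^ k) = mconst a ^ k"
  by (induction k) (simp_all add: mconst_mult)

lemma mconst_sum: "mconst (sum f A) = (\<Sum>a\<in>A. mconst (f a))"
  by (induction A rule: infinite_finite_induct) (simp_all add: mconst_add)

lemma mpoly_vars_mconst [simp]: "mpoly_vars (mconst c) = {}"
  by (auto simp: mpoly_vars_def mconst_def)

lemma mpoly_vars_0 [simp]: "mpoly_vars 0 = {}"
  using mpoly_vars_mconst[of 0] by simp

lemma mpoly_vars_1 [simp]: "mpoly_vars 1 = {}"
  using mpoly_vars_mconst[of 1] by simp

lemma mpoly_vars_mvar: "mpoly_vars (mvar y) \<subseteq> {y}"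
  by (auto simp: mpoly_vars_def mvar_def split: if_splits)

lemma mpoly_vars_add: "mpoly_vars (P + Q) \<subseteq> mpoly_vars P \<union> mpoly_vars Q"
  unfolding mpoly_vars_def using Poly_Mapping.keys_add[of P Q] by blast

lemma mpoly_vars_mult: "mpoly_vars (P * Q) \<subseteq> mpoly_vars P \<union> mpoly_vars Q"
proof
  fix y assume "y \<in> mpoly_vars (P * Q)"
  then obtain m where m: "m \<in> Poly_Mapping.keys (P * Q)" "y \<in> Poly_Mapping.keys m"
    by (auto simp: mpoly_vars_def)
  then obtain a b where "a \<in> Poly_Mapping.keys P" "b \<in> Poly_Mapping.keys Q" "m = a + b"
    using keys_mult[of P Q] by blast
  with m(2) Poly_Mapping.keys_add[of a b] show "y \<in> mpoly_vars P \<union> mpoly_vars Q"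
    by (auto simp: mpoly_vars_def)
qed

lemma mpoly_vars_sum: "mpoly_vars (sum f A) \<subseteq> (\<Union>a\<in>A. mpoly_vars (f a))"
proof (induction A rule: infinite_finite_induct)
  case (insert a A)
  then show ?case using mpoly_vars_add[of "f a" "sum f A"] by auto
qed auto

lemma multilinear_mconst [simp]: "multilinear (mconst c)"
  by (auto simp: multilinear_def mconst_def)

lemma multilinear_0 [simp]: "multilinear 0"
  using multilinear_mconst[of 0] by simp

lemma multilinear_1 [simp]: "multilinear 1"
  using multilinear_mconst[of 1] by simp

lemma multilinear_mvar [simp]: "multilinear (mvar y)"
  by (auto simp: multilinear_def mvar_def lookup_single when_def split: if_splits)

lemma multilinear_add:
  assumes "multilinear P" "multilinear Q"
  shows "multilinear (P + Q)"
  using assms Poly_Mapping.keys_add[of P Q] unfolding multilinear_def by blast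

lemma multilinear_sum:
  assumes "\<And>a. a \<in> A \<Longrightarrow> multilinear (f a)"
  shows "multilinear (sum f A)"
  using assms by (induction A rule: infinite_finite_induct) (auto intro: multilinear_add)

lemma multilinear_mult:
  assumes "multilinear P" "multilinear Q" "mpoly_vars P \<inter> mpoly_vars Q = {}"
  shows "multilinear (P * Q)"
  unfolding multilinear_def
proof (intro ballI allI)
  fix m y assume "m \<in> Poly_Mapping.keys (P * Q)"
  then obtain a b where ab: "a \<in> Poly_Mapping.keys P" "b \<in> Poly_Mapping.keys Q" "m = a + b"
    using keys_mult[of P Q] by blast
  then have "y \<notin> Poly_Mapping.keys a \<or> y \<notin> Poly_Mapping.keys b"
    using assms(3) by (auto simp: mpoly_vars_def)
  then show "Poly_Mapping.lookup m y \<le> 1"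
    using ab assms(1,2) by (auto simp: multilinear_def lookup_add in_keys_iff)
qed

section \<open>Sums of products of variable-disjoint affine forms\<close>

definition affine_form :: "'y set \<Rightarrow> 'a \<Rightarrow> ('y \<Rightarrow> 'a) \<Rightarrow> ('y, 'a::comm_ring_1) mpoly" where
  "affine_form Z a b = mconst a + (\<Sum>z\<in>Z. mconst (b z) * mvar z)"

text \<open>Disjoint blocks make the product multilinear. Nonempty blocks bound the number of
  factors by the size of the variable set, so that the formula size is linear in it.\<close>

inductive affine_product :: "'y set \<Rightarrow> ('y, 'a::comm_ring_1) mpoly \<Rightarrow> bool" where
  one: "affine_product {} 1"
| mult: "affine_product Y T \<Longrightarrow> finite Z \<Longrightarrow> Z \<noteq> {} \<Longrightarrow> Z \<inter> Y = {} \<Longrightarrow>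
    affine_product (Z \<union> Y) (affine_form Z a b * T)"

text \<open>Allowing 0 for every \<open>m\<close> turns the number of summands into an upper bound,
  and each summand may use its own subset of \<open>Y\<close>; both make the predicate
  monotone.\<close>

inductive sum_of_products :: "nat \<Rightarrow> 'y set \<Rightarrow> ('y, 'a::comm_ring_1) mpoly \<Rightarrow> bool" where
  zero: "sum_of_products m Y 0"
| add: "sum_of_products m Y P \<Longrightarrow> affine_product Z T \<Longrightarrow> Z \<subseteq> Y \<Longrightarrow>
    sum_of_products (Suc m) Y (mconst c * T + P)"

lemma affine_form_vars: "mpoly_vars (affine_form Z a b) \<subseteq> Z"
proof -
  have "mpoly_vars (mconst (b z) * mvar z) \<subseteq> {z}" for z
    using mpoly_vars_mult[of "mconst (b z)" "mvar z"] mpoly_vars_mvar[of z] by auto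
  then have "mpoly_vars (\<Sum>z\<in>Z. mconst (b z) * mvar z) \<subseteq> Z"
    using mpoly_vars_sum[of "\<lambda>z. mconst (b z) * mvar z" Z] by blast
  then show ?thesis
    unfolding affine_form_def
    using mpoly_vars_add[of "mconst a" "\<Sum>z\<in>Z. mconst (b z) * mvar z"] by auto
qed

lemma multilinear_affine_form: "multilinear (affine_form Z a b)"
  unfolding affine_form_def
  by (intro multilinear_add multilinear_sum multilinear_mult) auto

lemma affine_product_finite: "affine_product Y T \<Longrightarrow> finite Y"
  by (induction rule: affine_product.induct) auto

lemma affine_product_vars: "affine_product Y T \<Longrightarrow> mpoly_vars T \<subseteq> Y"
proof (induction rule: affine_product.induct)
  case (mult Y T Z a b)
  then show ?case
    using mpoly_vars_mult[of "affine_form Z a b" T] affine_form_vars[of Z a b] by blast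
qed auto

lemma affine_product_multilinear: "affine_product Y T \<Longrightarrow> multilinear T"
proof (induction rule: affine_product.induct)
  case (mult Y T Z a b)
  then show ?case
    using affine_form_vars[of Z a b] affine_product_vars[of Y T]
    by (intro multilinear_mult multilinear_affine_form) auto
qed auto

lemma affine_product_mult:
  "affine_product Y T \<Longrightarrow> affine_product Y' T' \<Longrightarrow> Y \<inter> Y' = {} \<Longrightarrow> affine_product (Y \<union> Y') (T * T')"
proof (induction rule: affine_product.induct)
  case (mult Y T Z a b)
  then have "affine_product (Z \<union> (Y \<union> Y')) (affine_form Z a b * (T * T'))"
    by (intro affine_product.mult) auto
  then show ?case by (simp add: Un_assoc mult.assoc)
qed auto

lemma affine_product_affine_form:
  "finite Z \<Longrightarrow> Z \<noteq> {} \<Longrightarrow> affine_product Z (affine_form Z a b)"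
  using affine_product.mult[OF affine_product.one, of Z a b] by simp

lemma affine_product_prod:
  assumes "finite A" "\<And>a. a \<in> A \<Longrightarrow> affine_product (Y a) (T a)"
    and "\<And>a b. a \<in> A \<Longrightarrow> b \<in> A \<Longrightarrow> a \<noteq> b \<Longrightarrow> Y a \<inter> Y b = {}"
  shows "affine_product (\<Union>a\<in>A. Y a) (\<Prod>a\<in>A. T a)"
  using assms
proof (induction A rule: finite_induct)
  case empty
  then show ?case by (simp add: affine_product.one)
next
  case (insert a A)
  then have "affine_product (Y a \<union> (\<Union>a\<in>A. Y a)) (T a * (\<Prod>a\<in>A. T a))"
    by (intro affine_product_mult) blast+
  then show ?case using insert by simp
qed

lemma sum_of_products_vars: "sum_of_products m Y P \<Longrightarrow> mpoly_vars P \<subseteq> Y"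
proof (induction rule: sum_of_products.induct)
  case (add m Y P Z T c)
  have "mpoly_vars (mconst c * T) \<subseteq> mpoly_vars T"
    using mpoly_vars_mult[of "mconst c" T] by simp
  also have "\<dots> \<subseteq> Z"
    using add.hyps(2) by (rule affine_product_vars)
  also note add.hyps(3)
  finally show ?case
    by (intro subset_trans[OF mpoly_vars_add] Un_least add.IH)
qed auto

lemma sum_of_products_mono:
  "sum_of_products m Y P \<Longrightarrow> m \<le> m' \<Longrightarrow> Y \<subseteq> Y' \<Longrightarrow> sum_of_products m' Y' P"
proof (induction arbitrary: m' rule: sum_of_products.induct)
  case (add m Y P Z T c)
  then obtain k where "m' = Suc k" "m \<le> k" by (cases m') auto
  with add show ?case by (auto intro!: sum_of_products.add)
qed (rule sum_of_products.zero)

lemma sum_of_products_add: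
  "sum_of_products m Y P \<Longrightarrow> sum_of_products m' Y P' \<Longrightarrow> sum_of_products (m + m') Y (P + P')"
proof (induction rule: sum_of_products.induct)
  case (zero m Y)
  then show ?case by (auto intro: sum_of_products_mono)
next
  case (add m Y P Z T c)
  then show ?case
    using sum_of_products.add[of "m + m'" Y "P + P'" Z T c] by (simp add: add.assoc)
qed

lemma sum_of_products_scale:
  "sum_of_products m Y P \<Longrightarrow> sum_of_products m Y (mconst c * P)"
proof (induction rule: sum_of_products.induct)
  case (add m Y P Z T d)
  then show ?case
    using sum_of_products.add[of m Y "mconst c * P" Z T "c * d"]
    by (simp add: distrib_left mconst_mult mult.assoc)
qed (simp add: sum_of_products.zero)

lemma sum_of_products_uminus:
  "sum_of_products m Y P \<Longrightarrow> sum_of_products m Y (- P)"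
  using sum_of_products_scale[of m Y P "- 1"] by (simp add: mconst_minus)

lemma sum_of_products_diff:
  "sum_of_products m Y P \<Longrightarrow> sum_of_products m' Y P' \<Longrightarrow> sum_of_products (m + m') Y (P - P')"
  using sum_of_products_add[OF _ sum_of_products_uminus, of m Y P m' P'] by simp

lemma sum_of_products_sum:
  assumes "\<And>a. a \<in> A \<Longrightarrow> sum_of_products m Y (P a)"
  shows "sum_of_products (card A * m) Y (\<Sum>a\<in>A. P a)"
  using assms
proof (induction A rule: infinite_finite_induct)
  case (insert a A)
  then have "sum_of_products (m + card A * m) Y (P a + (\<Sum>a\<in>A. P a))"
    by (intro sum_of_products_add) simp_all
  then show ?case using insert.hyps by simp
qed (simp_all add: sum_of_products.zero)

lemma sum_of_products_affine_product:
  "affine_product Z T \<Longrightarrow> Z \<subseteq> Y \<Longrightarrow> sum_of_products 1 Y T"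
  using sum_of_products.add[OF sum_of_products.zero, of Z T Y 0 1] by simp

lemma sum_of_products_affine_product_mult:
  "sum_of_products m Y P \<Longrightarrow> affine_product Z T \<Longrightarrow> Y \<inter> Z = {} \<Longrightarrow>
    sum_of_products m (Y \<union> Z) (T * P)"
proof (induction rule: sum_of_products.induct)
  case (add m Y P Z' T' c)
  then have "affine_product (Z \<union> Z') (T * T')"
    by (intro affine_product_mult) auto
  moreover have "sum_of_products m (Y \<union> Z) (T * P)"
    using add by simp
  ultimately have "sum_of_products (Suc m) (Y \<union> Z) (mconst c * (T * T') + T * P)"
    using add.hyps(3) by (intro sum_of_products.add) auto
  then show ?case by (simp add: distrib_left mult.left_commute)
qed (simp add: sum_of_products.zero)

text \<open>Distributing yields one product per pair of summands, and disjointness keeps each of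
  them an affine product. Expanding in this way, instead of placing a product gate on top, is what
  keeps the depth at 3.\<close>

lemma sum_of_products_mult:
  "sum_of_products m Y P \<Longrightarrow> sum_of_products m' Y' P' \<Longrightarrow> Y \<inter> Y' = {} \<Longrightarrow>
    sum_of_products (m * m') (Y \<union> Y') (P * P')"
proof (induction rule: sum_of_products.induct)
  case (add m Y P Z T c)
  have P': "sum_of_products m' Y' P'" and disj: "Y \<inter> Y' = {}"
    by fact+
  have "Y' \<inter> Z = {}" using disj add.hyps(3) by blast
  with P' add.hyps(2) have "sum_of_products m' (Y' \<union> Z) (T * P')"
    by (rule sum_of_products_affine_product_mult)
  moreover have "Y' \<union> Z \<subseteq> Y \<union> Y'" using add.hyps(3) by blast
  ultimately have "sum_of_products m' (Y \<union> Y') (T * P')"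
    by (rule sum_of_products_mono[OF _ order_refl])
  from sum_of_products_add[OF sum_of_products_scale[OF this] add.IH[OF P' disj]]
  show ?case by (simp only: distrib_right mult.assoc mult_Suc)
qed (simp add: sum_of_products.zero)

lemma sum_of_products_mult_subset:
  assumes "sum_of_products m Y P" "sum_of_products m' Y' P'" "Y \<inter> Y' = {}"
    and "Y \<subseteq> Z" "Y' \<subseteq> Z" "m * m' \<le> M"
  shows "sum_of_products M Z (P * P')"
  using sum_of_products_mono[OF sum_of_products_mult[OF assms(1-3)] assms(6)] assms(4,5) by simp

lemma sum_of_products_1: "sum_of_products 1 Y 1"
  by (rule sum_of_products_affine_product[OF affine_product.one]) auto

lemma affine_product_mvar: "affine_product {y} (mvar y)"
  using affine_product_affine_form[of "{y}" 0 "\<lambda>_. 1"] by (simp add: affine_form_def)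

lemma sum_of_products_mvar: "y \<in> Y \<Longrightarrow> sum_of_products 1 Y (mvar y)"
  by (rule sum_of_products_affine_product[OF affine_product_mvar]) auto

section \<open>Depth-3 formulas for sums of products\<close>

lemma multilinear_formula_Gate:
  assumes "Fs \<noteq> []" "\<And>c F. (c, F) \<in> set Fs \<Longrightarrow> multilinear_formula F"
    and "multilinear (computes (Gate g Fs))"
  shows "multilinear_formula (Gate g Fs)"
  using assms unfolding multilinear_formula_def arithmetic_formula_def by auto

lemma formula_vars_Gate:
  "formula_vars (Gate g Fs) = (\<Union>(c, F)\<in>set Fs. formula_vars F)"
  unfolding formula_vars_def by auto

lemma depth_Gate_le:
  assumes "\<And>c F. (c, F) \<in> set Fs \<Longrightarrow> depth F \<le> d"
  shows "depth (Gate g Fs) \<le> Suc d"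
  using assms by auto

lemma multilinear_formula_Var: "multilinear_formula (Var y)"
  by (simp add: multilinear_formula_def arithmetic_formula_def)

lemma multilinear_formula_Scalar: "multilinear_formula (Scalar c)"
  by (simp add: multilinear_formula_def arithmetic_formula_def)

lemma formula_vars_Var [simp]: "formula_vars (Var y) = {y}"
  by (auto simp: formula_vars_def)

lemma formula_vars_Scalar [simp]: "formula_vars (Scalar c) = {}"
  by (auto simp: formula_vars_def)

lemma affine_form_formula:
  assumes "finite Z" "Z \<noteq> {}"
  obtains F where "computes F = affine_form Z a b" "multilinear_formula F" "formula_vars F \<subseteq> Z"
    "depth F \<le> 1" "nodes F \<le> 3 * card Z"
proof -
  obtain zs where zs: "set zs = Z" "distinct zs"
    using finite_distinct_list[OF assms(1)] by blast
  \<comment> \<open>The coefficients are edge labels, so the children are leaves and the depth is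
    1.\<close>
  define F where "F = Gate Plus ((1, Scalar a) # map (\<lambda>z. (b z, Var z)) zs)"
  have 1: "computes F = affine_form Z a b"
    using zs by (simp add: F_def affine_form_def comp_def sum_list_distinct_conv_sum_set)
  have 2: "multilinear_formula F"
    unfolding F_def
    by (rule multilinear_formula_Gate)
      (use 1 in \<open>auto simp: F_def multilinear_affine_form
          intro: multilinear_formula_Var multilinear_formula_Scalar\<close>)
  have 3: "formula_vars F \<subseteq> Z"
    using zs by (auto simp: F_def formula_vars_Gate)
  have 4: "depth F \<le> 1"
  proof -
    have "depth H \<le> 0" if "(c, H) \<in> set ((1, Scalar a) # map (\<lambda>z. (b z, Var z)) zs)" for c H
      using that by auto
    then have "depth F \<le> Suc 0" unfolding F_def by (rule depth_Gate_le)
    then show ?thesis by simp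
  qed
  have "length zs = card Z" using zs distinct_card[of zs] by simp
  \<comment> \<open>The nodes are the gate, the constant and \<open>card Z\<close> variables;
    nonemptiness absorbs the first two into \<open>3 * card Z\<close>.\<close>
  moreover have "card Z > 0" using assms by (simp add: card_gt_0_iff)
  ultimately have 5: "nodes F \<le> 3 * card Z"
    by (simp add: F_def comp_def sum_list_triv)
  from 1 2 3 4 5 show thesis by (rule that)
qed

lemma affine_product_factor_formulas:
  "affine_product Y T \<Longrightarrow> \<exists>Fs. prod_list (map computes Fs) = T \<and>
    (\<forall>F\<in>set Fs. multilinear_formula F \<and> formula_vars F \<subseteq> Y \<and> depth F \<le> 1) \<and>
    sum_list (map nodes Fs) \<le> 3 * card Y"
proof (induction rule: affine_product.induct)
  case one
  then show ?case by (intro exI[of _ "[]"]) auto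
next
  case (mult Y T Z a b)
  then obtain Fs where Fs: "prod_list (map computes Fs) = T"
    "\<forall>F\<in>set Fs. multilinear_formula F \<and> formula_vars F \<subseteq> Y \<and> depth F \<le> 1"
    "sum_list (map nodes Fs) \<le> 3 * card Y" by blast
  obtain F where F: "computes F = affine_form Z a b" "multilinear_formula F" "formula_vars F \<subseteq> Z"
    "depth F \<le> 1" "nodes F \<le> 3 * card Z"
    using affine_form_formula[OF mult.hyps(2,3)] by blast
  have "card (Z \<union> Y) = card Z + card Y"
    using mult affine_product_finite by (intro card_Un_disjoint) auto
  then show ?case
    using Fs F by (intro exI[of _ "F # Fs"]) auto
qed

lemma affine_product_formula:
  assumes "affine_product Y T"
  obtains F where "computes F = T" "multilinear_formula F" "formula_vars F \<subseteq> Y"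
    "depth F \<le> 2" "nodes F \<le> 2 + 3 * card Y"
proof -
  obtain Fs where Fs: "prod_list (map computes Fs) = T"
    "\<forall>F\<in>set Fs. multilinear_formula F \<and> formula_vars F \<subseteq> Y \<and> depth F \<le> 1"
    "sum_list (map nodes Fs) \<le> 3 * card Y"
    using affine_product_factor_formulas[OF assms] by blast
  \<comment> \<open>The neutral child \<open>Scalar 1\<close> keeps the gate nonempty when there are
    no factors. It and the gate account for the 2 in the size bound.\<close>
  define F where "F = Gate Times ((1, Scalar 1) # map (Pair 1) Fs)"
  have 1: "computes F = T"
    using Fs(1) by (simp add: F_def comp_def)
  have 2: "multilinear_formula F"
    unfolding F_def
    by (rule multilinear_formula_Gate)
      (use 1 Fs affine_product_multilinear[OF assms] in
        \<open>auto simp: F_def intro: multilinear_formula_Scalar\<close>)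
  have 3: "formula_vars F \<subseteq> Y"
    using Fs by (auto simp: F_def formula_vars_Gate)
  have 4: "depth F \<le> 2"
    using depth_Gate_le[of "(1, Scalar 1) # map (Pair 1) Fs" 1] Fs by (auto simp: F_def)
  have 5: "nodes F \<le> 2 + 3 * card Y"
    using Fs(3) by (simp add: F_def comp_def)
  from 1 2 3 4 5 show thesis by (rule that)
qed

lemma sum_of_products_summand_formulas:
  "sum_of_products m Y P \<Longrightarrow> finite Y \<Longrightarrow> \<exists>Fs. sum_list (map (\<lambda>(c, F). mconst c * computes F) Fs) = P \<and>
    (\<forall>(c, F)\<in>set Fs. multilinear_formula F \<and> formula_vars F \<subseteq> Y \<and> depth F \<le> 2) \<and>
    sum_list (map (\<lambda>(c, F). nodes F) Fs) \<le> m * (2 + 3 * card Y)"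
proof (induction rule: sum_of_products.induct)
  case (zero m Y)
  then show ?case by (intro exI[of _ "[]"]) auto
next
  case (add m Y P Z T c)
  then obtain Fs where Fs: "sum_list (map (\<lambda>(c, F). mconst c * computes F) Fs) = P"
    "\<forall>(c, F)\<in>set Fs. multilinear_formula F \<and> formula_vars F \<subseteq> Y \<and> depth F \<le> 2"
    "sum_list (map (\<lambda>(c, F). nodes F) Fs) \<le> m * (2 + 3 * card Y)" by blast
  obtain F where F: "computes F = T" "multilinear_formula F" "formula_vars F \<subseteq> Z"
    "depth F \<le> 2" "nodes F \<le> 2 + 3 * card Z"
    using affine_product_formula[OF add.hyps(2)] by blast
  have "card Z \<le> card Y" using add by (intro card_mono) auto
  then show ?case
    using Fs F add.hyps by (intro exI[of _ "(c, F) # Fs"]) auto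
qed

lemma multilinear_sum_of_products: "sum_of_products m Y P \<Longrightarrow> multilinear P"
proof (induction rule: sum_of_products.induct)
  case (add m Y P Z T c)
  then show ?case
    using affine_product_multilinear[of Z T]
    by (intro multilinear_add multilinear_mult) auto
qed auto

text \<open>The three levels are the outer sum, the products and the affine forms; scalars in front
  of the products are edge labels and cost no depth.\<close>

lemma sum_of_products_formula:
  assumes "sum_of_products m Y P" "finite Y"
  obtains F where "computes F = P" "multilinear_formula F" "formula_vars F \<subseteq> Y"
    "depth F \<le> 3" "nodes F \<le> 2 + m * (2 + 3 * card Y)"
proof -
  obtain Fs where Fs: "sum_list (map (\<lambda>(c, F). mconst c * computes F) Fs) = P"
    "\<forall>(c, F)\<in>set Fs. multilinear_formula F \<and> formula_vars F \<subseteq> Y \<and> depth F \<le> 2"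
    "sum_list (map (\<lambda>(c, F). nodes F) Fs) \<le> m * (2 + 3 * card Y)"
    using sum_of_products_summand_formulas[OF assms] by blast
  \<comment> \<open>Again a neutral child, now for the empty sum.\<close>
  define F where "F = Gate Plus ((0, Scalar 0) # Fs)"
  have 1: "computes F = P"
    using Fs(1) by (simp add: F_def)
  have 2: "multilinear_formula F"
    unfolding F_def
    by (rule multilinear_formula_Gate)
      (use 1 Fs multilinear_sum_of_products[OF assms(1)] in
        \<open>auto simp: F_def intro: multilinear_formula_Scalar\<close>)
  have 3: "formula_vars F \<subseteq> Y"
    using Fs by (auto simp: F_def formula_vars_Gate)
  have 4: "depth F \<le> 3"
    using depth_Gate_le[of "(0, Scalar 0) # Fs" 2] Fs by (auto simp: F_def)
  have 5: "nodes F \<le> 2 + m * (2 + 3 * card Y)"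
    using Fs(3) by (simp add: F_def)
  from 1 2 3 4 5 show thesis by (rule that)
qed

section \<open>Derivations of bounded size\<close>

text \<open>Tree-like derivations from the lines \<open>\<Gamma>\<close>, counting the new lines. Every new line must be a sum
  of at most \<open>M\<close> products, which bounds its formula size.\<close>

inductive derives :: "'x set \<Rightarrow> ('x fmc_var, 'a::comm_ring_1) mpoly set \<Rightarrow> nat \<Rightarrow>
    ('x fmc_var, 'a) mpoly set \<Rightarrow> nat \<Rightarrow> ('x fmc_var, 'a) mpoly \<Rightarrow> bool"
  for X Q M \<Gamma> where
  line: "P \<in> \<Gamma> \<Longrightarrow> derives X Q M \<Gamma> 0 P"
| zero: "derives X Q M \<Gamma> 0 0"
| init: "P \<in> Q \<Longrightarrow> sum_of_products M (fmc_vars X) P \<Longrightarrow> derives X Q M \<Gamma> 1 P"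
| product: "derives X Q M \<Gamma> k P \<Longrightarrow> mpoly_vars q \<subseteq> fmc_vars X \<Longrightarrow>
    sum_of_products M (fmc_vars X) (q * P) \<Longrightarrow> derives X Q M \<Gamma> (k + 1) (q * P)"
| linear: "derives X Q M \<Gamma> k P \<Longrightarrow> derives X Q M \<Gamma> l R \<Longrightarrow>
    sum_of_products M (fmc_vars X) (mconst \<alpha> * P + mconst \<beta> * R) \<Longrightarrow>
    derives X Q M \<Gamma> (k + l + 1) (mconst \<alpha> * P + mconst \<beta> * R)"
| weaken: "derives X Q M \<Gamma> k P \<Longrightarrow> k \<le> l \<Longrightarrow> derives X Q M \<Gamma> l P"

lemma derives_add:
  assumes "derives X Q M \<Gamma> k P" "derives X Q M \<Gamma> l R" "sum_of_products M (fmc_vars X) (P + R)"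
  shows "derives X Q M \<Gamma> (k + l + 1) (P + R)"
  using derives.linear[OF assms(1,2), of 1 1] assms(3) by simp

lemma derives_diff:
  assumes "derives X Q M \<Gamma> k P" "derives X Q M \<Gamma> l R" "sum_of_products M (fmc_vars X) (P - R)"
  shows "derives X Q M \<Gamma> (k + l + 1) (P - R)"
  using derives.linear[OF assms(1,2), of 1 "-1"] assms(3) by (simp add: mconst_minus)

text \<open>Summands are added one at a time. Every partial sum has at most
  \<open>card I * m\<close> products and so respects the bound \<open>M\<close>; each summand costs
  its own \<open>k\<close> lines and one addition.\<close>

lemma derives_sum:
  assumes "finite I" "\<And>i. i \<in> I \<Longrightarrow> derives X Q M \<Gamma> k (P i)"
    and "\<And>i. i \<in> I \<Longrightarrow> sum_of_products m (fmc_vars X) (P i)" and "card I * m \<le> M"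
  shows "derives X Q M \<Gamma> (card I * (k + 1)) (\<Sum>i\<in>I. P i)"
  using assms
proof (induction I rule: finite_induct)
  case empty
  then show ?case by (simp add: derives.zero)
next
  case (insert i I)
  have "sum_of_products (card (insert i I) * m) (fmc_vars X) (\<Sum>i\<in>insert i I. P i)"
    by (rule sum_of_products_sum) (rule insert.prems)
  then have "sum_of_products M (fmc_vars X) (P i + (\<Sum>i\<in>I. P i))"
    using insert by (simp add: sum_of_products_mono)
  moreover have "derives X Q M \<Gamma> (card I * (k + 1)) (\<Sum>i\<in>I. P i)"
    using insert by simp
  ultimately have "derives X Q M \<Gamma> (k + card I * (k + 1) + 1) (P i + (\<Sum>i\<in>I. P i))"
    using insert.prems(1)[of i] by (intro derives_add) auto
  then show ?case using insert.hyps by (simp add: algebra_simps)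
qed

section \<open>From derivations to proofs as lists of formulas\<close>

definition bounded_proof ::
    "'x set \<Rightarrow> ('x fmc_var, 'a::comm_ring_1) mpoly set \<Rightarrow> nat \<Rightarrow> ('x fmc_var, 'a) formula list \<Rightarrow> bool" where
  "bounded_proof X Q M \<pi> \<longleftrightarrow> fmc_proof X Q \<pi> \<and>
     (\<forall>F\<in>set \<pi>. depth F \<le> 3 \<and> nodes F \<le> 2 + M * (2 + 3 * card (fmc_vars X)))"

lemma bounded_proof_Nil: "bounded_proof X Q M []"
  by (simp add: bounded_proof_def fmc_proof_def)

text \<open>Premises are identified by the polynomials they compute instead of their positions, so
  that later arguments can append lines without tracking indices.\<close>

lemma bounded_proof_extend:
  assumes \<pi>: "bounded_proof X Q M \<pi>" and fin: "finite X"
    and P: "sum_of_products M (fmc_vars X) P"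
    and rule: "P \<in> Q \<or>
      (\<exists>R\<in>computes ` set \<pi>. \<exists>q. mpoly_vars q \<subseteq> fmc_vars X \<and> P = q * R) \<or>
      (\<exists>R\<in>computes ` set \<pi>. \<exists>S\<in>computes ` set \<pi>. \<exists>\<alpha> \<beta>. P = mconst \<alpha> * R + mconst \<beta> * S)"
  obtains \<pi>' where "bounded_proof X Q M \<pi>'" "length \<pi>' = length \<pi> + 1"
    "computes ` set \<pi>' = insert P (computes ` set \<pi>)"
proof -
  have "finite (fmc_vars X)" using fin by (simp add: fmc_vars_def)
  from P this obtain F where F: "computes F = P" "multilinear_formula F" "formula_vars F \<subseteq> fmc_vars X"
    "depth F \<le> 3" "nodes F \<le> 2 + M * (2 + 3 * card (fmc_vars X))"
    by (rule sum_of_products_formula)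
  have ex: "\<exists>j<length \<pi>. R = computes ((\<pi> @ [F]) ! j)" if R: "R \<in> computes ` set \<pi>" for R
  proof -
    obtain G where "G \<in> set \<pi>" "R = computes G" using R by blast
    then obtain j where "j < length \<pi>" "R = computes (\<pi> ! j)"
      by (metis in_set_conv_nth)
    then show ?thesis by (intro exI[of _ j]) (simp add: nth_append)
  qed
  let ?J = "\<lambda>\<pi> i. computes (\<pi> ! i) \<in> Q \<or>
      computes (\<pi> ! i) \<in> boolean_axioms X \<or>
      (\<exists>j<i. \<exists>q. mpoly_vars q \<subseteq> fmc_vars X \<and> computes (\<pi> ! i) = q * computes (\<pi> ! j)) \<or>
      (\<exists>j<i. \<exists>k<i. \<exists>\<alpha> \<beta>. computes (\<pi> ! i) =
         mconst \<alpha> * computes (\<pi> ! j) + mconst \<beta> * computes (\<pi> ! k))"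
  have last: "?J (\<pi> @ [F]) (length \<pi>)"
    using rule
  proof (elim disjE bexE exE conjE)
    assume "P \<in> Q"
    then show ?thesis using F(1) by simp
  next
    fix R q assume R: "R \<in> computes ` set \<pi>" and q: "mpoly_vars q \<subseteq> fmc_vars X" "P = q * R"
    obtain j where "j < length \<pi>" "R = computes ((\<pi> @ [F]) ! j)" using ex[OF R] by blast
    with q have "\<exists>j<length \<pi>. \<exists>q. mpoly_vars q \<subseteq> fmc_vars X \<and>
        computes ((\<pi> @ [F]) ! length \<pi>) = q * computes ((\<pi> @ [F]) ! j)"
      using F(1) by auto
    then show ?thesis by blast
  next
    fix R S \<alpha> \<beta> assume R: "R \<in> computes ` set \<pi>" and S: "S \<in> computes ` set \<pi>"
      and eq: "P = mconst \<alpha> * R + mconst \<beta> * S"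
    obtain j where "j < length \<pi>" "R = computes ((\<pi> @ [F]) ! j)" using ex[OF R] by blast
    moreover obtain k where "k < length \<pi>" "S = computes ((\<pi> @ [F]) ! k)" using ex[OF S] by blast
    ultimately have "\<exists>j<length \<pi>. \<exists>k<length \<pi>. \<exists>\<alpha> \<beta>. computes ((\<pi> @ [F]) ! length \<pi>) =
        mconst \<alpha> * computes ((\<pi> @ [F]) ! j) + mconst \<beta> * computes ((\<pi> @ [F]) ! k)"
      using F(1) eq by auto
    then show ?thesis by blast
  qed
  have old: "?J (\<pi> @ [F]) i" if i: "i < length \<pi>" for i
  proof -
    have nth: "(\<pi> @ [F]) ! j = \<pi> ! j" if "j \<le> i" for j
      using that i by (simp add: nth_append)
    have "?J \<pi> i" using \<pi> i by (simp add: bounded_proof_def fmc_proof_def)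
    then show ?thesis
      by (elim disjE exE conjE) (metis nth order_refl less_imp_le)+
  qed
  have "fmc_proof X Q (\<pi> @ [F])"
    unfolding fmc_proof_def
  proof (intro allI impI)
    fix i assume "i < length (\<pi> @ [F])"
    then consider "i < length \<pi>" | "i = length \<pi>" by fastforce
    then show "multilinear_formula ((\<pi> @ [F]) ! i) \<and> formula_vars ((\<pi> @ [F]) ! i) \<subseteq> fmc_vars X \<and>
        ?J (\<pi> @ [F]) i"
    proof cases
      case 1
      then show ?thesis
        using \<pi> old[OF 1] by (simp add: nth_append bounded_proof_def fmc_proof_def)
    next
      case 2
      then show ?thesis using last F(2,3) by simp
    qed
  qed
  then have "bounded_proof X Q M (\<pi> @ [F])"
    using \<pi> F by (auto simp: bounded_proof_def)
  then show thesis by (rule that) (use F(1) in auto)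
qed

lemma derives_bounded_proof:
  assumes "derives X Q M \<Gamma> k P" "finite X"
  shows "bounded_proof X Q M \<pi> \<Longrightarrow> insert 0 \<Gamma> \<subseteq> computes ` set \<pi> \<Longrightarrow>
    \<exists>\<pi>'. bounded_proof X Q M \<pi>' \<and> length \<pi>' \<le> length \<pi> + k \<and>
      insert P (computes ` set \<pi>) \<subseteq> computes ` set \<pi>'"
  using assms(1)
proof (induction arbitrary: \<pi> rule: derives.induct)
  case (line P)
  then show ?case by (intro exI[of _ \<pi>]) auto
next
  case zero
  then show ?case by (intro exI[of _ \<pi>]) auto
next
  case (init P)
  obtain \<pi>' where "bounded_proof X Q M \<pi>'" "length \<pi>' = length \<pi> + 1"
    "computes ` set \<pi>' = insert P (computes ` set \<pi>)"
    by (rule bounded_proof_extend[OF init.prems(1) assms(2) init.hyps(2)]) (use init.hyps in auto)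
  then show ?case by (intro exI[of _ \<pi>']) simp
next
  case (product k P q)
  obtain \<pi>1 where 1: "bounded_proof X Q M \<pi>1" "length \<pi>1 \<le> length \<pi> + k"
    "insert P (computes ` set \<pi>) \<subseteq> computes ` set \<pi>1"
    using product.IH[OF product.prems] by blast
  have P: "P \<in> computes ` set \<pi>1" using 1(3) by blast
  obtain \<pi>' where 2: "bounded_proof X Q M \<pi>'" "length \<pi>' = length \<pi>1 + 1"
    "computes ` set \<pi>' = insert (q * P) (computes ` set \<pi>1)"
    by (rule bounded_proof_extend[OF 1(1) assms(2) product.hyps(3)])
      (use P product.hyps(2) in blast)
  have "insert (q * P) (computes ` set \<pi>) \<subseteq> computes ` set \<pi>'"
    unfolding 2(3) using 1(3) by blast
  then show ?case using 1(2) 2(1,2) by (intro exI[of _ \<pi>']) simp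
next
  case (linear k P l R \<alpha> \<beta>)
  obtain \<pi>1 where 1: "bounded_proof X Q M \<pi>1" "length \<pi>1 \<le> length \<pi> + k"
    "insert P (computes ` set \<pi>) \<subseteq> computes ` set \<pi>1"
    using linear.IH(1)[OF linear.prems] by blast
  have "insert 0 \<Gamma> \<subseteq> computes ` set \<pi>1" using 1(3) linear.prems(2) by blast
  from linear.IH(2)[OF 1(1) this] obtain \<pi>2 where 2: "bounded_proof X Q M \<pi>2"
    "length \<pi>2 \<le> length \<pi>1 + l" "insert R (computes ` set \<pi>1) \<subseteq> computes ` set \<pi>2"
    by blast
  have PR: "P \<in> computes ` set \<pi>2" "R \<in> computes ` set \<pi>2" using 1(3) 2(3) by blast+
  obtain \<pi>' where 3: "bounded_proof X Q M \<pi>'" "length \<pi>' = length \<pi>2 + 1"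
    "computes ` set \<pi>' = insert (mconst \<alpha> * P + mconst \<beta> * R) (computes ` set \<pi>2)"
    by (rule bounded_proof_extend[OF 2(1) assms(2) linear.hyps(3)]) (use PR in blast)
  have "insert (mconst \<alpha> * P + mconst \<beta> * R) (computes ` set \<pi>) \<subseteq> computes ` set \<pi>'"
    unfolding 3(3) using 1(3) 2(3) by blast
  then show ?case using 1(2) 2(2) 3(1,2) by (intro exI[of _ \<pi>']) simp
next
  case (weaken k P l)
  obtain \<pi>' where "bounded_proof X Q M \<pi>'" "length \<pi>' \<le> length \<pi> + k"
    "insert P (computes ` set \<pi>) \<subseteq> computes ` set \<pi>'"
    using weaken.IH[OF weaken.prems] by blast
  then show ?case using weaken.hyps(2) by (intro exI[of _ \<pi>']) simp
qed

text \<open>Lists only grow, so \<Gamma> stays available and the derivations for the members of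
  \<Delta> can be appended one after the other.\<close>

lemma derives_set_bounded_proof:
  assumes "finite \<Delta>" "\<And>P. P \<in> \<Delta> \<Longrightarrow> derives X Q M \<Gamma> k P" "finite X"
    "bounded_proof X Q M \<pi>" "insert 0 \<Gamma> \<subseteq> computes ` set \<pi>"
  shows "\<exists>\<pi>'. bounded_proof X Q M \<pi>' \<and> length \<pi>' \<le> length \<pi> + card \<Delta> * k \<and>
      \<Delta> \<union> computes ` set \<pi> \<subseteq> computes ` set \<pi>'"
  using assms
proof (induction \<Delta> rule: finite_induct)
  case empty
  then show ?case by (intro exI[of _ \<pi>]) simp
next
  case (insert P \<Delta>)
  obtain \<pi>1 where 1: "bounded_proof X Q M \<pi>1" "length \<pi>1 \<le> length \<pi> + card \<Delta> * k"
    "\<Delta> \<union> computes ` set \<pi> \<subseteq> computes ` set \<pi>1"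
    using insert.IH[OF insert.prems(1)[OF insertI2] insert.prems(2-4)] by blast
  have "insert 0 \<Gamma> \<subseteq> computes ` set \<pi>1" using 1(3) insert.prems(4) by blast
  from derives_bounded_proof[OF insert.prems(1)[OF insertI1] insert.prems(2) 1(1) this]
  obtain \<pi>' where 2: "bounded_proof X Q M \<pi>'" "length \<pi>' \<le> length \<pi>1 + k"
    "insert P (computes ` set \<pi>1) \<subseteq> computes ` set \<pi>'" by blast
  have "insert P \<Delta> \<union> computes ` set \<pi> \<subseteq> computes ` set \<pi>'" using 1(3) 2(3) by blast
  moreover have "length \<pi>' \<le> length \<pi> + card (insert P \<Delta>) * k"
    using 1(2) 2(2) insert.hyps by simp
  ultimately show ?case using 2(1) by blast
qed

lemma bounded_proof_refutation:
  assumes \<pi>: "bounded_proof X Q M \<pi>" and one: "1 \<in> computes ` set \<pi>"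
  obtains \<pi>' where "depth_fmc_refutation 3 X Q \<pi>'"
    "proof_size \<pi>' \<le> length \<pi> * (2 + M * (2 + 3 * card (fmc_vars X)))"
proof -
  obtain i where i: "i < length \<pi>" "computes (\<pi> ! i) = 1"
    using one by (metis imageE in_set_conv_nth)
  \<comment> \<open>A refutation has to end with 1, so the list is cut right behind a line that
    computes it; justifications only refer backwards and survive.\<close>
  define \<pi>' where "\<pi>' = take (Suc i) \<pi>"
  have "fmc_proof X Q \<pi>'"
    unfolding fmc_proof_def
  proof (intro allI impI)
    fix k assume "k < length \<pi>'"
    then have "k < length \<pi>" and nth: "\<pi>' ! j = \<pi> ! j" if "j \<le> k" for j
      using that by (simp_all add: \<pi>'_def)
    then show "multilinear_formula (\<pi>' ! k) \<and> formula_vars (\<pi>' ! k) \<subseteq> fmc_vars X \<and>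
     (computes (\<pi>' ! k) \<in> Q \<or>
      computes (\<pi>' ! k) \<in> boolean_axioms X \<or>
      (\<exists>j<k. \<exists>q. mpoly_vars q \<subseteq> fmc_vars X \<and> computes (\<pi>' ! k) = q * computes (\<pi>' ! j)) \<or>
      (\<exists>j<k. \<exists>l<k. \<exists>\<alpha> \<beta>. computes (\<pi>' ! k) =
         mconst \<alpha> * computes (\<pi>' ! j) + mconst \<beta> * computes (\<pi>' ! l)))"
      using \<pi> unfolding bounded_proof_def fmc_proof_def
      by (smt (verit, ccfv_SIG) less_imp_le order_refl)
  qed
  moreover have "last \<pi>' = \<pi> ! i" "\<pi>' \<noteq> []"
    using i(1) by (auto simp: \<pi>'_def take_Suc_conv_app_nth)
  moreover have sub: "set \<pi>' \<subseteq> set \<pi>" unfolding \<pi>'_def by (rule set_take_subset)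
  ultimately have "depth_fmc_refutation 3 X Q \<pi>'"
    using \<pi> i(2) by (auto simp: depth_fmc_refutation_def fmc_refutation_def bounded_proof_def)
  moreover have "proof_size \<pi>' \<le> length \<pi>' * (2 + M * (2 + 3 * card (fmc_vars X)))"
  proof -
    have "sum_list (map nodes \<pi>') \<le> sum_list (map (\<lambda>_. 2 + M * (2 + 3 * card (fmc_vars X))) \<pi>')"
      by (rule sum_list_mono) (use \<pi> sub in \<open>auto simp: bounded_proof_def\<close>)
    then show ?thesis by (simp add: proof_size_def sum_list_triv)
  qed
  moreover have "length \<pi>' \<le> length \<pi>" by (simp add: \<pi>'_def)
  ultimately show thesis by (meson that le_trans mult_le_mono1)
qed

section \<open>Coefficient sums over a residue class\<close>

text \<open>For positive \<open>p\<close> this is a coefficient of \<open>H\<close> modulo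
  \<open>z^p - 1\<close>. The residue is an integer so that shifts \<open>s - k\<close> need no
  truncated subtraction.\<close>

definition residue_coeff :: "nat \<Rightarrow> int \<Rightarrow> 'b::comm_ring_1 poly \<Rightarrow> 'b" where
  "residue_coeff p s H = (\<Sum>k\<le>degree H. if [int k = s] (mod int p) then coeff H k else 0)"

lemma residue_coeff_bound:
  assumes "degree H \<le> N"
  shows "residue_coeff p s H = (\<Sum>k\<le>N. if [int k = s] (mod int p) then coeff H k else 0)"
  unfolding residue_coeff_def
  by (rule sum.mono_neutral_left) (use assms in \<open>auto simp: coeff_eq_0\<close>)

lemma residue_coeff_0 [simp]: "residue_coeff p s 0 = 0"
  by (auto simp: residue_coeff_def intro: sum.neutral)

lemma residue_coeff_add: "residue_coeff p s (H + K) = residue_coeff p s H + residue_coeff p s K"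
proof -
  define N where "N = max (degree H) (degree K)"
  have N: "degree H \<le> N" "degree K \<le> N" "degree (H + K) \<le> N"
    using degree_add_le_max[of H K] by (simp_all add: N_def)
  show ?thesis
    unfolding residue_coeff_bound[OF N(1)] residue_coeff_bound[OF N(2)] residue_coeff_bound[OF N(3)]
      sum.distrib[symmetric] by (rule sum.cong) auto
qed

lemma residue_coeff_sum: "residue_coeff p s (\<Sum>a\<in>A. H a) = (\<Sum>a\<in>A. residue_coeff p s (H a))"
  by (induction A rule: infinite_finite_induct) (simp_all add: residue_coeff_add)

lemma residue_coeff_cong:
  assumes "[s = t] (mod int p)"
  shows "residue_coeff p s H = residue_coeff p t H"
proof -
  have "[int k = s] (mod int p) \<longleftrightarrow> [int k = t] (mod int p)" for k
    using assms cong_sym cong_trans by blast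
  then show ?thesis by (simp add: residue_coeff_def)
qed

lemma residue_coeff_1: "residue_coeff p s 1 = (if [0 = s] (mod int p) then 1 else 0)"
  by (simp add: residue_coeff_def)

lemma residue_coeff_monom_mult:
  "residue_coeff p s (monom c k * H) = c * residue_coeff p (s - int k) H"
proof -
  have deg: "degree (monom c k * H) \<le> k + degree H"
    using degree_mult_le[of "monom c k" H] degree_monom_le[of c k] by linarith
  have "residue_coeff p s (monom c k * H) =
      (\<Sum>j\<le>k + degree H. if [int j = s] (mod int p) then coeff (monom c k * H) j else 0)"
    by (rule residue_coeff_bound[OF deg])
  also have "\<dots> = (\<Sum>j\<in>(\<lambda>i. i + k) ` {..degree H}.
      if [int j = s] (mod int p) then coeff (monom c k * H) j else 0)"
  proof (rule sum.mono_neutral_right)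
    show "\<forall>j\<in>{..k + degree H} - (\<lambda>i. i + k) ` {..degree H}.
      (if [int j = s] (mod int p) then coeff (monom c k * H) j else 0) = 0"
    proof
      fix j assume j: "j \<in> {..k + degree H} - (\<lambda>i. i + k) ` {..degree H}"
      have "j < k"
      proof (rule ccontr)
        assume "\<not> j < k"
        then have "j = (j - k) + k" "j - k \<in> {..degree H}" using j by auto
        then show False using j by blast
      qed
      then show "(if [int j = s] (mod int p) then coeff (monom c k * H) j else 0) = 0"
        by (simp add: coeff_monom_mult)
    qed
  qed auto
  also have "\<dots> = (\<Sum>i\<le>degree H. if [int (i + k) = s] (mod int p) then coeff (monom c k * H) (i + k) else 0)"
    by (subst sum.reindex) (simp_all add: inj_on_def)
  also have "\<dots> = (\<Sum>i\<le>degree H. c * (if [int i = s - int k] (mod int p) then coeff H i else 0))"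
  proof (rule sum.cong)
    fix i
    have "[int (i + k) = s] (mod int p) \<longleftrightarrow> [int i = s - int k] (mod int p)"
      by (simp add: cong_iff_dvd_diff algebra_simps)
    then show "(if [int (i + k) = s] (mod int p) then coeff (monom c k * H) (i + k) else 0) =
        c * (if [int i = s - int k] (mod int p) then coeff H i else 0)"
      by (simp add: coeff_monom_mult)
  qed simp
  also have "\<dots> = c * residue_coeff p (s - int k) H"
    by (simp add: residue_coeff_def sum_distrib_left)
  finally show ?thesis .
qed

lemma residue_coeff_monom: "residue_coeff p s (monom c k) = (if [int k = s] (mod int p) then c else 0)"
  using residue_coeff_monom_mult[of p s c k 1]
  by (simp add: residue_coeff_1 cong_iff_dvd_diff dvd_diff_commute)

text \<open>Multiplication modulo \<open>z^p - 1\<close> is cyclic convolution of coefficient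
  sequences. The left factor is split into monomials, which only shift residues, and the exponents
  are regrouped by residue.\<close>

lemma residue_coeff_mult:
  assumes "p > 0"
  shows "residue_coeff p s (H * K) =
    (\<Sum>a<p. residue_coeff p (int a) H * residue_coeff p (s - int a) K)"
proof -
  have "residue_coeff p s (H * K) = residue_coeff p s (\<Sum>k\<le>degree H. monom (coeff H k) k * K)"
    by (subst poly_as_sum_of_monoms[of H, symmetric]) (simp add: sum_distrib_right)
  also have "\<dots> = (\<Sum>k\<le>degree H. coeff H k * residue_coeff p (s - int k) K)"
    by (simp add: residue_coeff_sum residue_coeff_monom_mult)
  also have "\<dots> = (\<Sum>k\<le>degree H. \<Sum>a<p.
      (if [int k = int a] (mod int p) then coeff H k else 0) * residue_coeff p (s - int a) K)"
  proof (rule sum.cong)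
    fix k
    \<comment> \<open>Every exponent \<open>k\<close> meets exactly one residue below
      \<open>p\<close>, namely \<open>k mod p\<close>.\<close>
    have "(\<Sum>a<p. (if [int k = int a] (mod int p) then coeff H k else 0) * residue_coeff p (s - int a) K)
        = (\<Sum>a<p. if a = k mod p then coeff H k * residue_coeff p (s - int a) K else 0)"
      by (rule sum.cong) (auto simp: cong_def zmod_int[symmetric])
    also have "\<dots> = coeff H k * residue_coeff p (s - int (k mod p)) K"
      using assms by simp
    also have "residue_coeff p (s - int (k mod p)) K = residue_coeff p (s - int k) K"
      by (rule residue_coeff_cong) (simp add: cong_def zmod_int mod_diff_right_eq)
    finally show "coeff H k * residue_coeff p (s - int k) K = (\<Sum>a<p.
      (if [int k = int a] (mod int p) then coeff H k else 0) * residue_coeff p (s - int a) K)"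
      by (rule sym)
  qed simp
  also have "\<dots> = (\<Sum>a<p. \<Sum>k\<le>degree H.
      (if [int k = int a] (mod int p) then coeff H k else 0) * residue_coeff p (s - int a) K)"
    by (rule sum.swap)
  also have "\<dots> = (\<Sum>a<p. residue_coeff p (int a) H * residue_coeff p (s - int a) K)"
    by (simp add: residue_coeff_def sum_distrib_right)
  finally show ?thesis .
qed

text \<open>Summing the coefficients with index in \<open>S\<close> is a linear functional on
  polynomials of degree at most \<open>N\<close>, hence a linear combination of the values at
  \<open>N + 1\<close> distinct points. The statement gives it on the monomials.\<close>

lemma interpolation_weights:
  fixes S :: "nat set"
  obtains w :: "nat \<Rightarrow> 'a::field_char_0"
    where "\<And>k. k \<le> N \<Longrightarrow> (\<Sum>t\<le>N. w t * of_nat t ^ k) = (if k \<in> S then 1 else 0)"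
proof -
  \<comment> \<open>The Lagrange basis polynomial that is 1 at the node \<open>t\<close> and 0 at
    the other nodes.\<close>
  define L :: "nat \<Rightarrow> 'a poly" where
    "L t = (\<Prod>u\<in>{..N} - {t}. smult (inverse (of_nat t - of_nat u)) [:- of_nat u, 1:])" for t
  have deg_L: "degree (L t) \<le> N" if "t \<le> N" for t
  proof -
    have "degree (L t) \<le> sum (degree \<circ> (\<lambda>u. smult (inverse (of_nat t - of_nat u :: 'a)) [:- of_nat u, 1:])) ({..N} - {t})"
      unfolding L_def by (rule degree_prod_sum_le) simp
    also have "\<dots> \<le> (\<Sum>u\<in>{..N} - {t}. 1)"
      by (rule sum_mono) simp
    also have "\<dots> = N" using that by simp
    finally show ?thesis .
  qed
  have poly_L: "poly (L t) (of_nat u) = (if t = u then 1 else 0)" if "t \<le> N" "u \<le> N" for t u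
  proof (cases "t = u")
    case True
    have "poly (smult (inverse (of_nat t - of_nat v)) [:- of_nat v, 1:]) (of_nat t :: 'a) = 1"
      if "v \<noteq> t" for v
    proof -
      have "poly (smult (inverse (of_nat t - of_nat v)) [:- of_nat v, 1:]) (of_nat t :: 'a)
          = inverse (of_nat t - of_nat v) * (of_nat t - of_nat v)"
        by (simp add: algebra_simps)
      then show ?thesis using that by simp
    qed
    then have "(\<Prod>v\<in>{..N} - {t}. poly (smult (inverse (of_nat t - of_nat v)) [:- of_nat v, 1:]) (of_nat t :: 'a)) = 1"
      by (intro prod.neutral) blast
    then show ?thesis using True by (simp add: L_def poly_prod)
  next
    case False
    then have "\<exists>v\<in>{..N} - {t}. poly (smult (inverse (of_nat t - of_nat v)) [:- of_nat v, 1:]) (of_nat u :: 'a) = 0"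
      using that by (intro bexI[of _ u]) auto
    then have "(\<Prod>v\<in>{..N} - {t}. poly (smult (inverse (of_nat t - of_nat v)) [:- of_nat v, 1:]) (of_nat u :: 'a)) = 0"
      by (intro prod_zero) auto
    then show ?thesis using False by (simp add: L_def poly_prod)
  qed
  \<comment> \<open>Otherwise the difference of the two sides would be a nonzero polynomial of
    degree at most \<open>N\<close> with \<open>N + 1\<close> roots; the nodes are distinct by
    characteristic 0.\<close>
  have lagrange: "monom 1 k = (\<Sum>t\<le>N. smult (of_nat t ^ k) (L t))" if k: "k \<le> N" for k
  proof (rule ccontr)
    let ?D = "monom 1 k - (\<Sum>t\<le>N. smult (of_nat t ^ k) (L t))"
    assume "monom 1 k \<noteq> (\<Sum>t\<le>N. smult (of_nat t ^ k) (L t))"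
    then have D: "?D \<noteq> 0" by simp
    have "degree (\<Sum>t\<le>N. smult (of_nat t ^ k) (L t)) \<le> N"
      by (rule degree_sum_le) (auto simp: deg_L)
    then have "degree ?D \<le> N"
      using k degree_monom_le[of "1 :: 'a" k] by (intro degree_diff_le) auto
    moreover have "of_nat ` {..N} \<subseteq> {x. poly ?D x = 0}"
    proof
      fix x :: 'a assume "x \<in> of_nat ` {..N}"
      then obtain u where u: "x = of_nat u" "u \<le> N" by auto
      have "(\<Sum>t\<le>N. of_nat t ^ k * poly (L t) (of_nat u)) = (\<Sum>t\<le>N. if t = u then of_nat u ^ k else (0 :: 'a))"
        by (rule sum.cong) (use u(2) in \<open>auto simp: poly_L\<close>)
      then show "x \<in> {x. poly ?D x = 0}"
        using u by (simp add: poly_sum poly_monom)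
    qed
    then have "card (of_nat ` {..N} :: 'a set) \<le> degree ?D"
      by (rule order_trans[OF card_mono[OF poly_roots_finite[OF D]] card_poly_roots_bound[OF D]])
    moreover have "card (of_nat ` {..N} :: 'a set) = Suc N"
      by (subst card_image) (auto simp: inj_on_def)
    ultimately show False by linarith
  qed
  \<comment> \<open>The weight is the functional applied to the basis polynomial of the
    node.\<close>
  define w where "w t = (\<Sum>j\<in>S \<inter> {..N}. coeff (L t) j)" for t
  have "(\<Sum>t\<le>N. w t * of_nat t ^ k) = (if k \<in> S then 1 else 0)" if "k \<le> N" for k
  proof -
    have "(\<Sum>t\<le>N. w t * of_nat t ^ k) = (\<Sum>t\<le>N. \<Sum>j\<in>S \<inter> {..N}. of_nat t ^ k * coeff (L t) j)"
      by (simp add: w_def sum_distrib_left mult.commute[of "sum _ _"])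
    also have "\<dots> = (\<Sum>j\<in>S \<inter> {..N}. \<Sum>t\<le>N. of_nat t ^ k * coeff (L t) j)"
      by (rule sum.swap)
    also have "\<dots> = (\<Sum>j\<in>S \<inter> {..N}. coeff (monom 1 k :: 'a poly) j)"
      by (simp add: lagrange[OF that] coeff_sum)
    also have "\<dots> = (if k \<in> S then 1 else 0)"
      using that by (simp add: coeff_monom)
    finally show ?thesis .
  qed
  then show thesis by (rule that)
qed

lemma prod_monom:
  "(\<Prod>k\<in>A. monom (c k) (d k)) = monom (\<Prod>k\<in>A. c k) (\<Sum>k\<in>A. d k :: nat)"
  by (induction A rule: infinite_finite_induct) (simp_all add: mult_monom)

section \<open>Generating functions of edge sets\<close>

text \<open>The coefficient of \<open>z ^ k\<close> in \<open>edge_prod p A\<close> enumerates the assignments to \<open>A\<close> of sum \<open>k\<close>, so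
  \<open>flow p A s\<close> says that the values of the edges in \<open>A\<close> add up to \<open>s\<close> modulo \<open>p\<close>.\<close>

abbreviation edge_var :: "'v \<times> 'v \<Rightarrow> nat \<Rightarrow> ('v tseitin_var fmc_var, 'a::comm_ring_1) mpoly" where
  "edge_var e i \<equiv> mvar (Pos (e, i))"

definition edge_vars :: "nat \<Rightarrow> ('v \<times> 'v) set \<Rightarrow> 'v tseitin_var fmc_var set" where
  "edge_vars p A = Pos ` (A \<times> {..<p})"

definition edge_poly :: "nat \<Rightarrow> 'v \<times> 'v \<Rightarrow> ('v tseitin_var fmc_var, 'a::comm_ring_1) mpoly poly" where
  "edge_poly p e = (\<Sum>i<p. monom (edge_var e i) i)"

definition edge_prod :: "nat \<Rightarrow> ('v \<times> 'v) set \<Rightarrow> ('v tseitin_var fmc_var, 'a::comm_ring_1) mpoly poly" where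
  "edge_prod p A = (\<Prod>e\<in>A. edge_poly p e)"

definition flow :: "nat \<Rightarrow> ('v \<times> 'v) set \<Rightarrow> int \<Rightarrow> ('v tseitin_var fmc_var, 'a::comm_ring_1) mpoly" where
  "flow p A s = residue_coeff p s (edge_prod p A)"

lemma flow_cong: "[s = t] (mod int p) \<Longrightarrow> flow p A s = flow p A t"
  unfolding flow_def by (rule residue_coeff_cong)

lemma flow_empty: "flow p {} s = (if [0 = s] (mod int p) then 1 else 0)"
  by (simp add: flow_def edge_prod_def residue_coeff_1)

lemma flow_Un:
  assumes "finite A" "finite B" "A \<inter> B = {}" "p > 0"
  shows "flow p (A \<union> B) s = (\<Sum>a<p. flow p A (int a) * flow p B (s - int a))"
  using assms by (simp add: flow_def edge_prod_def prod.union_disjoint residue_coeff_mult)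

lemma flow_insert:
  assumes "finite A" "e \<notin> A"
  shows "flow p (insert e A) s = (\<Sum>i<p. edge_var e i * flow p A (s - int i))"
  using assms by (simp add: flow_def edge_prod_def edge_poly_def sum_distrib_right
      residue_coeff_sum residue_coeff_monom_mult)

lemma degree_edge_poly: "degree (edge_poly p e) \<le> p"
  unfolding edge_poly_def
  by (rule degree_sum_le) (auto intro: order_trans[OF degree_monom_le])

lemma degree_edge_prod:
  assumes "finite A"
  shows "degree (edge_prod p A) \<le> card A * p"
  unfolding edge_prod_def
  by (rule order_trans[OF degree_prod_sum_le[OF assms]], rule order_trans[OF sum_mono[of A _ "\<lambda>_. p"]])
    (simp_all add: degree_edge_poly)

text \<open>Interpolating at \<open>0, \<dots>, N\<close> (here characteristic 0 is used) replaces the exponentially many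
  monomials of a flow by few products of affine forms.\<close>

lemma flow_sum_of_products:
  assumes A: "finite A" and p: "p > 0"
  shows "sum_of_products (card A * p + 1) (edge_vars p A)
    (flow p A s :: ('v tseitin_var fmc_var, 'a::field_char_0) mpoly)"
proof -
  \<comment> \<open>Each edge contributes degree below \<open>p\<close>; rounding up to
    \<open>p\<close> avoids a subtraction. The nodes 0 to \<open>N\<close> give the
    \<open>card A * p + 1\<close> products.\<close>
  define N where "N = card A * p"
  define G where "G = (edge_prod p A :: ('v tseitin_var fmc_var, 'a) mpoly poly)"
  have deg: "degree G \<le> N"
    unfolding G_def N_def by (rule degree_edge_prod[OF A])
  obtain w :: "nat \<Rightarrow> 'a" where w: "\<And>k. k \<le> N \<Longrightarrow>
      (\<Sum>t\<le>N. w t * of_nat t ^ k) = (if k \<in> {k. [int k = s] (mod int p)} then 1 else 0)"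
    using interpolation_weights by blast
  have poly_G: "poly G x = (\<Sum>k\<le>N. coeff G k * x ^ k)" for x
    using arg_cong[OF poly_as_sum_of_monoms'[OF deg], of "\<lambda>H. poly H x"]
    by (simp add: poly_sum poly_monom)
  have "(\<Sum>t\<le>N. mconst (w t) * poly G (mconst (of_nat t))) =
      (\<Sum>t\<le>N. \<Sum>k\<le>N. coeff G k * mconst (w t * of_nat t ^ k))"
    by (simp add: poly_G sum_distrib_left mconst_mult mconst_power mult.left_commute)
  also have "\<dots> = (\<Sum>k\<le>N. \<Sum>t\<le>N. coeff G k * mconst (w t * of_nat t ^ k))"
    by (rule sum.swap)
  also have "\<dots> = (\<Sum>k\<le>N. coeff G k * mconst (\<Sum>t\<le>N. w t * of_nat t ^ k))"
    by (simp only: sum_distrib_left mconst_sum)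
  also have "\<dots> = (\<Sum>k\<le>N. if [int k = s] (mod int p) then coeff G k else 0)"
    by (rule sum.cong) (auto simp: w)
  also have "\<dots> = flow p A s"
    by (simp add: flow_def G_def[symmetric] residue_coeff_bound[OF deg])
  finally have flow: "flow p A s = (\<Sum>t\<le>N. mconst (w t) * poly G (mconst (of_nat t)))" ..
  have prod: "affine_product (edge_vars p A) (poly G (mconst (of_nat t)))" for t
  proof -
    \<comment> \<open>Evaluating at the constant \<open>t\<close> turns the factor of an edge into
      an affine form in which the variable of value \<open>i\<close> has coefficient
      \<open>t ^ i\<close>. The value at \<open>Neg\<close> is a default: \<open>edge_vars\<close>
      consists of \<open>Pos\<close> variables.\<close>
    define b where "b z = (case z of Pos y \<Rightarrow> of_nat t ^ snd y | Neg _ \<Rightarrow> (0 :: 'a))"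
      for z :: "'v tseitin_var fmc_var"
    have "poly (edge_poly p e) (mconst (of_nat t)) = affine_form (edge_vars p {e}) 0 b" for e
    proof -
      have "edge_vars p {e} = (\<lambda>i. Pos (e, i)) ` {..<p}"
        by (auto simp: edge_vars_def)
      then have "affine_form (edge_vars p {e}) 0 b = (\<Sum>i<p. mconst (of_nat t ^ i) * edge_var e i)"
        by (simp add: affine_form_def sum.reindex inj_on_def b_def)
      then show ?thesis
        by (simp add: edge_poly_def poly_sum poly_monom mconst_power mult.commute)
    qed
    then have "poly G (mconst (of_nat t)) = (\<Prod>e\<in>A. affine_form (edge_vars p {e}) 0 b)"
      by (simp add: G_def edge_prod_def poly_prod)
    moreover have "affine_product (\<Union>e\<in>A. edge_vars p {e}) (\<Prod>e\<in>A. affine_form (edge_vars p {e}) 0 b)"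
      by (rule affine_product_prod[OF A])
        (use p in \<open>auto intro!: affine_product_affine_form simp: edge_vars_def\<close>)
    moreover have "(\<Union>e\<in>A. edge_vars p {e}) = edge_vars p A"
      by (auto simp: edge_vars_def)
    ultimately show ?thesis by simp
  qed
  have "sum_of_products (card {..N} * 1) (edge_vars p A)
      (\<Sum>t\<le>N. mconst (w t) * poly G (mconst (of_nat t)))"
    by (intro sum_of_products_sum sum_of_products_scale sum_of_products_affine_product[OF prod]) simp
  then show ?thesis by (simp add: flow N_def)
qed

section \<open>Deriving the contradiction\<close>

lemma translate_eq_var_eq:
  "translate_eq (var_eq x c :: ('x, 'a::field) lin_eq) = mvar (Pos x) - mconst c"
  by (simp add: translate_eq_def var_eq_def)

lemma residue_negate_negate: "i < p \<Longrightarrow> (p - (p - i) mod p) mod (p::nat) = i"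
  by (cases "i = 0") auto

lemma residue_negate_cong: "i < p \<Longrightarrow> [int ((p - i) mod p) = - int i] (mod int p)"
  by (simp add: cong_def zmod_int of_nat_diff)

locale tseitin_instance =
  fixes V :: "'v set" and E :: "'v set set" and p r :: nat and out :: "'v \<Rightarrow> nat \<Rightarrow> 'v \<times> 'v"
  assumes p_ge_2: "p \<ge> 2"
    and simple: "simple_graph V E"
    and card_V: "[card V = 1] (mod p)"
    and out_enum: "out_enumeration V E r out"
begin

abbreviation "D \<equiv> directed_edges E"
abbreviation "X \<equiv> tseitin_vars E p"
abbreviation "Ax \<equiv> translate ` neg_tseitin V E p r out"
text \<open>The number of products in the flow of all directed edges, of which there are
  \<open>card V * r\<close>; it bounds the number for every subset.\<close>

definition "B = card V * r * p + 1"

text \<open>The bound \<open>M\<close> holds the sums of assignments to the \<open>r\<close> edges of a vertex and the sums of up to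
  \<open>4 * p\<^sup>2\<close> terms, each the product of two flows.\<close>

definition "M = p ^ r + 4 * p\<^sup>2 * B\<^sup>2"

definition out_edges :: "'v set \<Rightarrow> ('v \<times> 'v) set" where
  "out_edges S = {e \<in> D. fst e \<in> S}"

lemma p_pos: "p > 0"
  using p_ge_2 by simp

lemma finite_V: "finite V"
  using simple by (simp add: simple_graph_def)

lemma directed_edge: "(u, v) \<in> D \<Longrightarrow> u \<in> V \<and> v \<in> V \<and> u \<noteq> v \<and> (v, u) \<in> D"
  using simple by (auto simp: simple_graph_def directed_edges_def doubleton_eq_iff insert_commute)

lemma D_subset: "D \<subseteq> V \<times> V"
  using directed_edge by auto

lemma finite_D: "finite D"
  using finite_subset[OF D_subset] finite_V by blast

lemma bij_out: "v \<in> V \<Longrightarrow> bij_betw (out v) {1..r} (out_edges {v})"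
  using out_enum by (simp add: out_enumeration_def out_edges_def)

lemma card_out_edges: "v \<in> V \<Longrightarrow> card (out_edges {v}) = r"
  using bij_betw_same_card[OF bij_out] by simp

lemma card_D: "card D = card V * r"
proof -
  have "D = (\<Union>v\<in>V. out_edges {v})"
    using D_subset by (auto simp: out_edges_def)
  also have "card \<dots> = (\<Sum>v\<in>V. card (out_edges {v}))"
    by (rule card_UN_disjoint) (use finite_V finite_D in \<open>auto simp: out_edges_def\<close>)
  finally show ?thesis by (simp add: card_out_edges)
qed

lemma fmc_vars_X: "fmc_vars X = edge_vars p D \<union> Neg ` X"
  by (auto simp: fmc_vars_def edge_vars_def tseitin_vars_def lessThan_atLeast0)

lemma edge_vars_subset: "A \<subseteq> D \<Longrightarrow> edge_vars p A \<subseteq> fmc_vars X"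
  by (auto simp: fmc_vars_X edge_vars_def)

lemma edge_var_mem: "e \<in> D \<Longrightarrow> i < p \<Longrightarrow> Pos (e, i) \<in> fmc_vars X"
  by (auto simp: fmc_vars_X edge_vars_def)

lemma finite_X: "finite X"
  using finite_D by (simp add: tseitin_vars_def)

lemma card_fmc_vars: "card (fmc_vars X) \<le> 2 * (card V * r * p)"
proof -
  have "card X = card V * r * p"
    by (simp add: tseitin_vars_def card_cartesian_product card_D)
  then show ?thesis
    unfolding fmc_vars_def
    using card_Un_le[of "Pos ` X" "Neg ` X"] card_image_le[OF finite_X, of Pos]
      card_image_le[OF finite_X, of Neg] by linarith
qed

section \<open>Size bounds for flows and their products\<close>

lemma B_pos: "B \<ge> 1"
  by (simp add: B_def)

lemma M_ge: "a \<le> 4 * p\<^sup>2 * B\<^sup>2 \<Longrightarrow> a \<le> M"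
  by (simp add: M_def)

lemma M_ge_const: "a \<le> 4 * p\<^sup>2 \<Longrightarrow> a \<le> M"
proof (rule M_ge)
  assume "a \<le> 4 * p\<^sup>2"
  also have "4 * p\<^sup>2 * 1 \<le> 4 * p\<^sup>2 * B\<^sup>2"
    using B_pos by (intro mult_le_mono2) simp
  finally show "a \<le> 4 * p\<^sup>2 * B\<^sup>2" by simp
qed

lemma p_le_square: "2 * p \<le> p\<^sup>2" "4 \<le> p\<^sup>2"
proof -
  show "2 * p \<le> p\<^sup>2" unfolding power2_eq_square using p_ge_2 by (intro mult_le_mono1)
  then show "4 \<le> p\<^sup>2" using p_ge_2 by linarith
qed

lemma M_ge_linear: "a \<le> 3 * p + 4 \<Longrightarrow> a \<le> M"
  using p_le_square by (intro M_ge_const) linarith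

lemma M_ge_B: "a \<le> 4 * p\<^sup>2 * B \<Longrightarrow> a \<le> M"
proof (rule M_ge)
  assume "a \<le> 4 * p\<^sup>2 * B"
  also have "4 * p\<^sup>2 * B \<le> 4 * p\<^sup>2 * B\<^sup>2"
    unfolding power2_eq_square[of B] using B_pos by (intro mult_le_mono2) simp
  finally show "a \<le> 4 * p\<^sup>2 * B\<^sup>2" .
qed

lemma M_ge_BB: "a \<le> p * (B * B) \<Longrightarrow> a \<le> M"
proof (rule M_ge)
  assume "a \<le> p * (B * B)"
  also have "p * (B * B) \<le> (4 * p\<^sup>2) * (B * B)"
    using p_le_square by (intro mult_le_mono1) linarith
  finally show "a \<le> 4 * p\<^sup>2 * B\<^sup>2" by (simp add: power2_eq_square)
qed

lemma flow_bound:
  assumes "A \<subseteq> D"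
  shows "sum_of_products B (edge_vars p A) (flow p A s :: ('v tseitin_var fmc_var, 'a::field_char_0) mpoly)"
proof -
  have "finite A" using assms finite_D finite_subset by blast
  moreover have "card A * p + 1 \<le> B"
    using card_mono[OF finite_D assms] by (simp add: B_def card_D)
  ultimately show ?thesis
    using sum_of_products_mono[OF flow_sum_of_products[OF _ p_pos]] by blast
qed

lemma flow_vars: "A \<subseteq> D \<Longrightarrow> mpoly_vars (flow p A s :: ('v tseitin_var fmc_var, 'a::field_char_0) mpoly) \<subseteq> fmc_vars X"
  using sum_of_products_vars[OF flow_bound] edge_vars_subset by blast

lemma edge_var_vars: "e \<in> D \<Longrightarrow> i < p \<Longrightarrow> mpoly_vars (edge_var e i) \<subseteq> fmc_vars X"
  using mpoly_vars_mvar edge_var_mem by fastforce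

lemma edge_var_bound: "e \<in> D \<Longrightarrow> i < p \<Longrightarrow> sum_of_products 1 (fmc_vars X) (edge_var e i)"
  by (rule sum_of_products_mvar[OF edge_var_mem])

lemma edge_var_mult_bound:
  assumes "e \<in> D" "e' \<in> D" "i < p" "j < p" "(e, i) \<noteq> (e', j)"
  shows "sum_of_products 1 (fmc_vars X) (edge_var e i * edge_var e' j)"
  by (rule sum_of_products_mult_subset[OF sum_of_products_mvar[of _ "{Pos (e, i)}"]
        sum_of_products_mvar[of _ "{Pos (e', j)}"]])
    (use assms edge_var_mem in auto)

section \<open>Initial polynomials and their consequences for a pair of opposite edges\<close>

lemma init_some_value:
  assumes "e \<in> D"
  shows "(\<Prod>i<p. edge_var e i - 1) \<in> (Ax :: ('v tseitin_var fmc_var, 'a::field) mpoly set)"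
proof (rule image_eqI)
  show "map (\<lambda>i. var_eq (e, i) (1::'a)) [0..<p] \<in> neg_tseitin V E p r out"
    unfolding neg_tseitin_def using assms by blast
  show "(\<Prod>i<p. edge_var e i - 1) = translate (map (\<lambda>i. var_eq (e, i) (1::'a)) [0..<p])"
    by (simp add: translate_def comp_def translate_eq_var_eq prod.distinct_set_conv_list[symmetric]
        lessThan_atLeast0)
qed

lemma init_one_value:
  assumes "e \<in> D" "i < p" "j < p" "i \<noteq> j"
  shows "edge_var e i * edge_var e j \<in> (Ax :: ('v tseitin_var fmc_var, 'a::field) mpoly set)"
proof (rule image_eqI)
  show "[var_eq (e, i) 0, var_eq (e, j) (0::'a)] \<in> neg_tseitin V E p r out"
    unfolding neg_tseitin_def using assms by blast
qed (simp add: translate_def translate_eq_var_eq)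

lemma init_opposite_1:
  assumes "(u, v) \<in> D" "i < p"
  shows "(edge_var (u, v) i - 1) * edge_var (v, u) ((p - i) mod p)
      \<in> (Ax :: ('v tseitin_var fmc_var, 'a::field) mpoly set)"
proof (rule image_eqI)
  show "[var_eq ((u, v), i) 1, var_eq ((v, u), (p - i) mod p) (0::'a)] \<in> neg_tseitin V E p r out"
    unfolding neg_tseitin_def using assms by blast
qed (simp add: translate_def translate_eq_var_eq)

lemma init_opposite_2:
  assumes "(u, v) \<in> D" "i < p"
  shows "edge_var (u, v) i * (edge_var (v, u) ((p - i) mod p) - 1)
      \<in> (Ax :: ('v tseitin_var fmc_var, 'a::field) mpoly set)"
proof (rule image_eqI)
  show "[var_eq ((u, v), i) 0, var_eq ((v, u), (p - i) mod p) (1::'a)] \<in> neg_tseitin V E p r out"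
    unfolding neg_tseitin_def using assms by blast
qed (simp add: translate_def translate_eq_var_eq)

lemma init_vertex:
  assumes "v \<in> V" "\<forall>k\<in>{1..r}. i k < p" "\<not> [(\<Sum>k=1..r. i k) = 1] (mod p)"
  shows "(\<Prod>k=1..r. edge_var (out v k) (i k)) \<in> (Ax :: ('v tseitin_var fmc_var, 'a::field) mpoly set)"
proof (rule image_eqI)
  show "map (\<lambda>k. var_eq (out v k, i k) (0::'a)) [1..<Suc r] \<in> neg_tseitin V E p r out"
    unfolding neg_tseitin_def using assms by blast
  have "{1..r} = set [1..<Suc r]" by auto
  then show "(\<Prod>k=1..r. edge_var (out v k) (i k)) =
      translate (map (\<lambda>k. var_eq (out v k, i k) (0::'a)) [1..<Suc r])"
    by (simp only: translate_def map_map comp_def translate_eq_var_eq mconst_0 diff_0_right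
        prod.distinct_set_conv_list[OF distinct_upt])
qed

text \<open>Subtracting the axiom \<open>x * (y - 1)\<close> from the axiom
  \<open>(x - 1) * y\<close> cancels the quadratic terms.\<close>

lemma derive_opposite:
  fixes \<Gamma> :: "('v tseitin_var fmc_var, 'a::field) mpoly set"
  assumes uv: "(u, v) \<in> D" and i: "i < p"
  shows "derives X Ax M \<Gamma> 3 (edge_var (u, v) i - edge_var (v, u) ((p - i) mod p))"
proof -
  let ?x = "edge_var (u, v) i :: ('v tseitin_var fmc_var, 'a) mpoly"
  let ?y = "edge_var (v, u) ((p - i) mod p) :: ('v tseitin_var fmc_var, 'a) mpoly"
  have vu: "(v, u) \<in> D" "u \<noteq> v" using directed_edge[OF uv] by auto
  have j: "(p - i) mod p < p" using p_pos by simp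
  note x = edge_var_bound[OF uv i] and y = edge_var_bound[OF vu(1) j]
  have xy: "sum_of_products 1 (fmc_vars X) (?x * ?y)"
    using vu(2) by (intro edge_var_mult_bound uv vu(1) i j) auto
  have M: "1 + 1 \<le> M" by (rule M_ge_linear) simp
  have "derives X Ax M \<Gamma> 1 ((?x - 1) * ?y)"
    using sum_of_products_mono[OF sum_of_products_diff[OF xy y] M subset_refl]
    by (intro derives.init init_opposite_1 uv i) (simp add: left_diff_distrib)
  moreover have "derives X Ax M \<Gamma> 1 (?x * (?y - 1))"
    using sum_of_products_mono[OF sum_of_products_diff[OF xy x] M subset_refl]
    by (intro derives.init init_opposite_2 uv i) (simp add: right_diff_distrib)
  moreover have eq: "(?x - 1) * ?y - ?x * (?y - 1) = ?x - ?y"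
    by (simp add: left_diff_distrib right_diff_distrib)
  moreover have "sum_of_products M (fmc_vars X) ((?x - 1) * ?y - ?x * (?y - 1))"
    unfolding eq by (rule sum_of_products_mono[OF sum_of_products_diff[OF x y] M subset_refl])
  ultimately have "derives X Ax M \<Gamma> (1 + 1 + 1) ((?x - 1) * ?y - ?x * (?y - 1))"
    by (intro derives_diff)
  then show ?thesis unfolding eq by (rule derives.weaken) simp
qed

text \<open>By \<open>derive_opposite\<close> the second factor may be replaced by the variable of
  \<open>(u, v)\<close> with the value opposite to \<open>j\<close>. That value differs from
  \<open>i\<close>, so the result is the axiom excluding two values on one edge.\<close>

lemma derive_cross:
  fixes \<Gamma> :: "('v tseitin_var fmc_var, 'a::field) mpoly set"
  assumes uv: "(u, v) \<in> D" and i: "i < p" and j: "j < p" and ne: "j \<noteq> (p - i) mod p"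
  shows "derives X Ax M \<Gamma> 6 (edge_var (u, v) i * edge_var (v, u) j)"
proof -
  define i' where "i' = (p - j) mod p"
  have i': "i' < p" "(p - i') mod p = j" "i \<noteq> i'"
    using p_pos residue_negate_negate[OF j] ne by (auto simp: i'_def)
  have vu: "(v, u) \<in> D" "u \<noteq> v" using directed_edge[OF uv] by auto
  let ?x = "edge_var (u, v) i :: ('v tseitin_var fmc_var, 'a) mpoly"
  let ?x' = "edge_var (u, v) i' :: ('v tseitin_var fmc_var, 'a) mpoly"
  let ?y = "edge_var (v, u) j :: ('v tseitin_var fmc_var, 'a) mpoly"
  have xx': "sum_of_products 1 (fmc_vars X) (?x * ?x')"
    using i'(3) by (intro edge_var_mult_bound uv i i'(1)) auto
  have xy: "sum_of_products 1 (fmc_vars X) (?x * ?y)"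
    using vu(2) by (intro edge_var_mult_bound uv vu(1) i j) auto
  have M: "1 \<le> M" "1 + 1 \<le> M" by (auto intro: M_ge_linear)
  have "derives X Ax M \<Gamma> 3 (?x' - ?y)"
    using derive_opposite[OF uv i'(1)] i'(2) by simp
  then have "derives X Ax M \<Gamma> (3 + 1) (?x * (?x' - ?y))"
    by (rule derives.product[OF _ edge_var_vars[OF uv i]])
      (use sum_of_products_mono[OF sum_of_products_diff[OF xx' xy] M(2) subset_refl] in
        \<open>simp add: right_diff_distrib\<close>)
  moreover have "derives X Ax M \<Gamma> 1 (?x * ?x')"
    by (intro derives.init init_one_value uv i i' sum_of_products_mono[OF xx' M(1)] subset_refl)
  moreover have eq: "?x * ?x' - ?x * (?x' - ?y) = ?x * ?y"
    by (simp add: right_diff_distrib)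
  moreover have "sum_of_products M (fmc_vars X) (?x * ?x' - ?x * (?x' - ?y))"
    unfolding eq by (rule sum_of_products_mono[OF xy M(1) subset_refl])
  ultimately have "derives X Ax M \<Gamma> (1 + (3 + 1) + 1) (?x * ?x' - ?x * (?x' - ?y))"
    by (intro derives_diff)
  then show ?thesis unfolding eq by (rule derives.weaken) simp
qed

text \<open>The difference of \<open>\<Prod>i<k. 1 - x i\<close> and its linear part is a combination of the
  \<open>x i * x j\<close>; for \<open>k = p\<close> the product is an axiom up to sign.\<close>

lemma derive_product_linear_part:
  fixes \<Gamma> :: "('v tseitin_var fmc_var, 'a::field) mpoly set"
  assumes e: "e \<in> D"
  shows "k \<le> p \<Longrightarrow> derives X Ax M \<Gamma> (k * (2 * p + 2))
    ((\<Prod>i<k. 1 - edge_var e i) - (1 - (\<Sum>i<k. edge_var e i)))"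
proof (induction k)
  case 0
  then show ?case by (simp add: derives.zero)
next
  case (Suc k)
  then have k: "k < p" by simp
  let ?x = "\<lambda>i. edge_var e i :: ('v tseitin_var fmc_var, 'a) mpoly"
  let ?P = "\<lambda>k. (\<Prod>i<k. 1 - ?x i)" and ?S = "\<lambda>k. 1 - (\<Sum>i<k. ?x i)"
  define Y where "Y k = (\<Union>i<k. {Pos (e, i)})" for k :: nat
  have Y: "Y k \<subseteq> fmc_vars X" if "k \<le> p" for k
    using that edge_var_mem[OF e] by (auto simp: Y_def)
  have affine: "affine_product {Pos (e, i)} (1 - ?x i)" for i
    using affine_product_affine_form[of "{Pos (e, i)}" 1 "\<lambda>_. -1"]
    by (simp add: affine_form_def mconst_minus)
  have bound: "sum_of_products (k + 2) (Y k) (?P k - ?S k)" for k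
  proof -
    have "affine_product (Y k) (?P k)"
      unfolding Y_def by (rule affine_product_prod) (auto intro: affine)
    then have "sum_of_products 1 (Y k) (?P k)"
      by (rule sum_of_products_affine_product) simp
    moreover have "sum_of_products (card {..<k} * 1) (Y k) (\<Sum>i<k. ?x i)"
      by (rule sum_of_products_sum, rule sum_of_products_mvar) (auto simp: Y_def)
    ultimately have "sum_of_products (1 + (1 + card {..<k} * 1)) (Y k) (?P k - ?S k)"
      by (intro sum_of_products_diff sum_of_products_1)
    then show ?thesis by simp
  qed
  have "sum_of_products (1 * (k + 2)) ({Pos (e, k)} \<union> Y k) ((1 - ?x k) * (?P k - ?S k))"
    by (rule sum_of_products_mult[OF sum_of_products_affine_product[OF affine subset_refl] bound])
      (auto simp: Y_def)
  moreover have "1 * (k + 2) \<le> M" using k by (intro M_ge_linear) simp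
  moreover have "{Pos (e, k)} \<union> Y k \<subseteq> fmc_vars X" using Y[of k] edge_var_mem[OF e k] k by simp
  ultimately have b1: "sum_of_products M (fmc_vars X) ((1 - ?x k) * (?P k - ?S k))"
    by (rule sum_of_products_mono)
  have vars: "mpoly_vars (1 - ?x k) \<subseteq> fmc_vars X"
    using affine_product_vars[OF affine[of k]] edge_var_mem[OF e k] by blast
  have d1: "derives X Ax M \<Gamma> (k * (2 * p + 2) + 1) ((1 - ?x k) * (?P k - ?S k))"
    using Suc.IH k by (intro derives.product[OF _ vars b1]) simp
  have M: "card {..<k} * 1 \<le> M" "1 \<le> M" using k by (auto intro: M_ge_linear)
  have b2: "sum_of_products 1 (fmc_vars X) (?x k * ?x i)" if "i \<in> {..<k}" for i
    using that k by (intro edge_var_mult_bound e) auto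
  have i2: "derives X Ax M \<Gamma> 1 (?x k * ?x i)" if "i \<in> {..<k}" for i
    using that k
    by (intro derives.init init_one_value e sum_of_products_mono[OF b2[OF that] M(2) subset_refl]) auto
  have d2: "derives X Ax M \<Gamma> (card {..<k} * (1 + 1)) (\<Sum>i<k. ?x k * ?x i)"
    by (rule derives_sum[OF finite_lessThan i2 b2 M(1)])
  \<comment> \<open>Expanding \<open>(1 - ?x k) * ?S k\<close> gives \<open>?S (Suc k)\<close> and
    the quadratic terms \<open>?x k * ?x i\<close>, which are axioms and are added back.\<close>
  have eq: "(1 - ?x k) * (?P k - ?S k) + (\<Sum>i<k. ?x k * ?x i) = ?P (Suc k) - ?S (Suc k)"
    unfolding sum_distrib_left[symmetric] by (simp add: algebra_simps)
  have "Suc k + 2 \<le> M" using k by (intro M_ge_linear) simp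
  then have "sum_of_products M (fmc_vars X) ((1 - ?x k) * (?P k - ?S k) + (\<Sum>i<k. ?x k * ?x i))"
    unfolding eq using Y[of "Suc k"] k by (intro sum_of_products_mono[OF bound]) auto
  from derives_add[OF d1 d2 this]
  have "derives X Ax M \<Gamma> (k * (2 * p + 2) + 1 + card {..<k} * (1 + 1) + 1) (?P (Suc k) - ?S (Suc k))"
    unfolding eq .
  \<comment> \<open>The step adds \<open>2 * k + 2\<close> lines: one multiplication, two for each
    quadratic term, and one addition.\<close>
  then show ?case by (rule derives.weaken) (use k in simp)
qed

text \<open>At \<open>k = p\<close> the product \<open>?P\<close> is an axiom up to the sign
  \<open>(-1) ^ p\<close>. Subtracting it from the difference \<open>?P - ?S\<close>, which is
  already derived, leaves the linear part alone.\<close>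

lemma derive_sum_values:
  fixes \<Gamma> :: "('v tseitin_var fmc_var, 'a::field) mpoly set"
  assumes e: "e \<in> D"
  shows "derives X Ax M \<Gamma> (p * (2 * p + 2) + 3) ((\<Sum>i<p. edge_var e i) - 1)"
proof -
  let ?x = "\<lambda>i. edge_var e i :: ('v tseitin_var fmc_var, 'a) mpoly"
  let ?P = "\<Prod>i<p. 1 - ?x i" and ?S = "1 - (\<Sum>i<p. ?x i)"
  have sign: "?P = mconst ((- 1) ^ p) * (\<Prod>i<p. ?x i - 1)"
  proof -
    have "?P = (\<Prod>i<p. (- 1) * (?x i - 1))" by simp
    also have "\<dots> = (- 1) ^ p * (\<Prod>i<p. ?x i - 1)" by (simp only: prod.distrib) simp
    finally show ?thesis by (simp add: mconst_power mconst_minus)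
  qed
  have affine: "affine_product {Pos (e, i)} (?x i - 1)" for i
    using affine_product_affine_form[of "{Pos (e, i)}" "-1" "\<lambda>_. 1"]
    by (simp add: affine_form_def mconst_minus)
  have "affine_product (\<Union>i<p. {Pos (e, i)}) (\<Prod>i<p. ?x i - 1)"
    by (rule affine_product_prod) (auto intro: affine)
  then have "sum_of_products 1 (fmc_vars X) (\<Prod>i<p. ?x i - 1)"
    using edge_var_mem[OF e] by (intro sum_of_products_affine_product) auto
  moreover have "1 \<le> M" by (rule M_ge_linear) simp
  ultimately have bound: "sum_of_products M (fmc_vars X) (\<Prod>i<p. ?x i - 1)"
    by (rule sum_of_products_mono) simp
  have "derives X Ax M \<Gamma> 1 (\<Prod>i<p. ?x i - 1)"
    by (rule derives.init[OF init_some_value[OF e] bound])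
  then have dP: "derives X Ax M \<Gamma> (1 + 1) ?P"
    unfolding sign by (rule derives.product) (simp_all add: sum_of_products_scale[OF bound])
  have eq: "?P - ?S - ?P = (\<Sum>i<p. ?x i) - 1" by simp
  have "sum_of_products (card {..<p} * 1 + 1) (fmc_vars X) ((\<Sum>i<p. ?x i) - 1)"
    by (intro sum_of_products_diff sum_of_products_sum sum_of_products_1 edge_var_bound e) simp
  moreover have "card {..<p} * 1 + 1 \<le> M" by (rule M_ge_linear) simp
  ultimately have "sum_of_products M (fmc_vars X) (?P - ?S - ?P)"
    unfolding eq by (rule sum_of_products_mono) simp
  from derives_diff[OF derive_product_linear_part[OF e order_refl] dP this]
  show ?thesis unfolding eq by (rule derives.weaken) simp
qed

text \<open>The axioms \<open>x * (y - 1)\<close> turn each value of \<open>(u, v)\<close> into the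
  product with its opposite value on \<open>(v, u)\<close>; the values of \<open>(u, v)\<close> sum
  to 1 by \<open>derive_sum_values\<close>.\<close>

lemma derive_matching:
  fixes \<Gamma> :: "('v tseitin_var fmc_var, 'a::field) mpoly set"
  assumes uv: "(u, v) \<in> D"
  shows "derives X Ax M \<Gamma> (p * (2 * p + 4) + 4)
    ((\<Sum>i<p. edge_var (u, v) i * edge_var (v, u) ((p - i) mod p)) - 1)"
proof -
  let ?x = "\<lambda>i. edge_var (u, v) i :: ('v tseitin_var fmc_var, 'a) mpoly"
  let ?y = "\<lambda>i. edge_var (v, u) ((p - i) mod p) :: ('v tseitin_var fmc_var, 'a) mpoly"
  have vu: "(v, u) \<in> D" "u \<noteq> v" using directed_edge[OF uv] by auto
  have xy: "sum_of_products 1 (fmc_vars X) (?x i * ?y i)" if "i \<in> {..<p}" for i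
    using that vu(2) p_pos by (intro edge_var_mult_bound uv vu(1)) auto
  have b: "sum_of_products (1 + 1) (fmc_vars X) (?x i * (?y i - 1))" if "i \<in> {..<p}" for i
    using sum_of_products_diff[OF xy[OF that] edge_var_bound[OF uv, of i]] that
    by (simp add: right_diff_distrib)
  have M: "1 + 1 \<le> M" "card {..<p} * (1 + 1) \<le> M" "card {..<p} * 1 + 1 \<le> M"
    by (auto intro: M_ge_linear)
  have "derives X Ax M \<Gamma> 1 (?x i * (?y i - 1))" if "i \<in> {..<p}" for i
    using that sum_of_products_mono[OF b[OF that] M(1) subset_refl]
    by (intro derives.init init_opposite_2 uv) auto
  from derives_sum[OF finite_lessThan this b M(2)]
  have d1: "derives X Ax M \<Gamma> (card {..<p} * (1 + 1)) (\<Sum>i<p. ?x i * (?y i - 1))" .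
  have eq: "(\<Sum>i<p. ?x i * (?y i - 1)) + ((\<Sum>i<p. ?x i) - 1) = (\<Sum>i<p. ?x i * ?y i) - 1"
    by (simp add: right_diff_distrib sum_subtractf)
  have "sum_of_products (card {..<p} * 1 + 1) (fmc_vars X) ((\<Sum>i<p. ?x i * ?y i) - 1)"
    by (intro sum_of_products_diff sum_of_products_sum sum_of_products_1 xy)
  then have "sum_of_products M (fmc_vars X) ((\<Sum>i<p. ?x i * (?y i - 1)) + ((\<Sum>i<p. ?x i) - 1))"
    unfolding eq using M(3) by (rule sum_of_products_mono) simp
  from derives_add[OF d1 derive_sum_values[OF uv] this]
  show ?thesis unfolding eq by (rule derives.weaken) (simp add: algebra_simps)
qed

text \<open>The larger flow is split by the values \<open>i\<close>, \<open>j\<close> of the two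
  edges. If they do not cancel modulo \<open>p\<close>, the term is a multiple of a product that
  \<open>derive_cross\<close> refutes. If they cancel, the rest must still have total
  \<open>s\<close>, so all these terms share the factor \<open>flow p A s\<close>, and their
  cofactors sum to 1 by \<open>derive_matching\<close>.\<close>

lemma derive_remove_edge_pair:
  fixes \<Gamma> :: "('v tseitin_var fmc_var, 'a::field_char_0) mpoly set"
  assumes A: "A \<subseteq> D" and uv: "(u, v) \<in> D" and notin: "(u, v) \<notin> A" "(v, u) \<notin> A"
    and \<Gamma>: "flow p (insert (u, v) (insert (v, u) A)) s \<in> \<Gamma>"
  shows "derives X Ax M \<Gamma> (10 * p\<^sup>2 + 4 * p + 7) (flow p A s)"
proof -
  let ?x = "\<lambda>i. edge_var (u, v) i :: ('v tseitin_var fmc_var, 'a) mpoly"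
  let ?y = "\<lambda>i. edge_var (v, u) i :: ('v tseitin_var fmc_var, 'a) mpoly"
  let ?f = "\<lambda>s. flow p A s :: ('v tseitin_var fmc_var, 'a) mpoly"
  define I where "I = Sigma {..<p} (\<lambda>i. {..<p} - {(p - i) mod p})"
  define W where "W = (\<Sum>(i, j)\<in>I. ?f (s - int i - int j) * (?x i * ?y j))"
  define R where "R = (\<Sum>i<p. ?x i * ?y ((p - i) mod p))"
  have vu: "(v, u) \<in> D" "u \<noteq> v" using directed_edge[OF uv] by auto
  have fin: "finite A" using A finite_D finite_subset by blast
  have IJ: "i < p" "j < p" "j \<noteq> (p - i) mod p" if "(i, j) \<in> I" for i j
    using that by (auto simp: I_def)
  have finI: "finite I" by (simp add: I_def)
  have cardI: "card I \<le> p\<^sup>2"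
  proof -
    have "I \<subseteq> {..<p} \<times> {..<p}" by (auto simp: I_def)
    then have "card I \<le> card ({..<p} \<times> {..<p})" by (intro card_mono) simp_all
    then show ?thesis by (simp add: power2_eq_square)
  qed
  have full: "flow p (insert (u, v) (insert (v, u) A)) s = W + ?f s * R"
  proof -
    have "flow p (insert (u, v) (insert (v, u) A)) s =
        (\<Sum>i<p. \<Sum>j<p. ?f (s - int i - int j) * (?x i * ?y j))"
      using fin notin vu(2) by (simp add: flow_insert sum_distrib_left mult_ac)
    also have "\<dots> = (\<Sum>i<p. ?f s * (?x i * ?y ((p - i) mod p))
        + (\<Sum>j\<in>{..<p} - {(p - i) mod p}. ?f (s - int i - int j) * (?x i * ?y j)))"
    proof (rule sum.cong)
      fix i assume i: "i \<in> {..<p}"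
      have "[s - int i - int ((p - i) mod p) = s - int i - (- int i)] (mod int p)"
        using residue_negate_cong[of i p] i by (intro cong_diff cong_refl) auto
      then have "?f (s - int i - int ((p - i) mod p)) = ?f s"
        using flow_cong by fastforce
      moreover have "(p - i) mod p \<in> {..<p}" using p_pos by simp
      ultimately show "(\<Sum>j<p. ?f (s - int i - int j) * (?x i * ?y j)) =
          ?f s * (?x i * ?y ((p - i) mod p))
          + (\<Sum>j\<in>{..<p} - {(p - i) mod p}. ?f (s - int i - int j) * (?x i * ?y j))"
        by (simp add: sum.remove[OF finite_lessThan])
    qed simp
    also have "\<dots> = ?f s * R + W"
      by (simp add: sum.distrib R_def W_def I_def sum_distrib_left sum.Sigma)
    finally show ?thesis by (simp add: add.commute)
  qed
  \<comment> \<open>Both edges lie outside \<open>A\<close>, so a flow times one variable of each is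
    multilinear and still has at most \<open>B\<close> products.\<close>
  have disj: "edge_vars p A \<inter> {Pos ((u, v), i), Pos ((v, u), j)} = {}" for i j
    using notin by (auto simp: edge_vars_def)
  have A': "edge_vars p A \<subseteq> fmc_vars X" by (rule edge_vars_subset[OF A])
  note f = flow_bound[OF A] and f' = sum_of_products_mono[OF flow_bound[OF A] order_refl A']
  have fxy: "sum_of_products B (fmc_vars X) (?f t * (?x i * ?y j))" if ij: "i < p" "j < p" for i j t
  proof -
    have "sum_of_products (1 * 1) ({Pos ((u, v), i)} \<union> {Pos ((v, u), j)}) (?x i * ?y j)"
      using vu(2) by (intro sum_of_products_mult sum_of_products_mvar) auto
    then have "sum_of_products 1 {Pos ((u, v), i), Pos ((v, u), j)} (?x i * ?y j)"
      by (simp add: insert_commute)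
    then show ?thesis
      by (rule sum_of_products_mult_subset[OF f _ disj A'])
        (use ij edge_var_mem[OF uv] edge_var_mem[OF vu(1)] in auto)
  qed
  have fR: "sum_of_products (p * B) (fmc_vars X) (?f s * R)"
  proof -
    have "sum_of_products (card {..<p} * B) (fmc_vars X) (\<Sum>i<p. ?f s * (?x i * ?y ((p - i) mod p)))"
      by (rule sum_of_products_sum, rule fxy) (use p_pos in auto)
    then show ?thesis by (simp add: R_def sum_distrib_left)
  qed
  have MB: "B \<le> M" "p\<^sup>2 * B \<le> M" "p * B \<le> M" "p * B + B \<le> M"
  proof -
    have "p * B + B \<le> 4 * p\<^sup>2 * B"
      using p_le_square mult_le_mono1[of "p + 1" "4 * p\<^sup>2" B] by simp
    then show "p * B + B \<le> M" by (rule M_ge_B)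
    then show "B \<le> M" "p * B \<le> M" by simp_all
    show "p\<^sup>2 * B \<le> M" by (rule M_ge_B) simp
  qed
  have dW: "derives X Ax M \<Gamma> (card I * (7 + 1)) W"
    unfolding W_def
  proof (rule derives_sum[OF finI])
    fix q assume "q \<in> I"
    then obtain i j where q: "q = (i, j)" "(i, j) \<in> I" by (cases q) auto
    have b: "sum_of_products B (fmc_vars X) (?f (s - int i - int j) * (?x i * ?y j))"
      using fxy IJ[OF q(2)] by simp
    have "derives X Ax M \<Gamma> (6 + 1) (?f (s - int i - int j) * (?x i * ?y j))"
      by (rule derives.product[OF derive_cross[OF uv IJ[OF q(2)]] flow_vars[OF A]
            sum_of_products_mono[OF b MB(1) subset_refl]])
    then show "derives X Ax M \<Gamma> 7 (case q of (i, j) \<Rightarrow> ?f (s - int i - int j) * (?x i * ?y j))"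
      unfolding q(1) prod.case by (rule derives.weaken) simp
    show "sum_of_products B (fmc_vars X) (case q of (i, j) \<Rightarrow> ?f (s - int i - int j) * (?x i * ?y j))"
      unfolding q(1) prod.case by (rule b)
  next
    show "card I * B \<le> M" using mult_le_mono1[OF cardI] MB(2) by (rule le_trans)
  qed
  have dfull: "derives X Ax M \<Gamma> 0 (W + ?f s * R)"
    using \<Gamma> unfolding full by (rule derives.line)
  have eq1: "W + ?f s * R - W = ?f s * R" by simp
  have "sum_of_products M (fmc_vars X) (W + ?f s * R - W)"
    unfolding eq1 by (rule sum_of_products_mono[OF fR MB(3) subset_refl])
  from derives_diff[OF dfull dW this]
  have dfR: "derives X Ax M \<Gamma> (0 + card I * (7 + 1) + 1) (?f s * R)"
    unfolding eq1 .
  have "sum_of_products M (fmc_vars X) (?f s * (R - 1))"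
    using sum_of_products_mono[OF sum_of_products_diff[OF fR f'] MB(4) subset_refl]
    by (simp add: right_diff_distrib)
  then have dfR1: "derives X Ax M \<Gamma> (p * (2 * p + 4) + 4 + 1) (?f s * (R - 1))"
    unfolding R_def by (rule derives.product[OF derive_matching[OF uv] flow_vars[OF A]])
  have eq2: "?f s * R - ?f s * (R - 1) = ?f s" by (simp add: right_diff_distrib)
  have "sum_of_products M (fmc_vars X) (?f s * R - ?f s * (R - 1))"
    unfolding eq2 by (rule sum_of_products_mono[OF f' MB(1) subset_refl])
  from derives_diff[OF dfR dfR1 this]
  \<comment> \<open>The constant consists of 8 lines for each of at most \<open>p^2\<close> values
    that do not cancel, \<open>p * (2 * p + 4) + 4\<close> for the matching, and 3 for one
    multiplication and two subtractions.\<close>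
  have "derives X Ax M \<Gamma> (0 + card I * (7 + 1) + 1 + (p * (2 * p + 4) + 4 + 1) + 1) (?f s)"
    unfolding eq2 .
  then show ?thesis
    by (rule derives.weaken) (use cardI in \<open>simp add: power2_eq_square algebra_simps\<close>)
qed

section \<open>Vertex axioms and convolution over vertices\<close>

lemma vertex_product_bound:
  assumes v: "v \<in> V" and g: "\<forall>k\<in>{1..r}. g k < p"
  shows "sum_of_products 1 (fmc_vars X) (\<Prod>k=1..r. edge_var (out v k) (g k))"
proof (rule sum_of_products_affine_product)
  have inj: "inj_on (out v) {1..r}"
    using bij_out[OF v] by (rule bij_betw_imp_inj_on)
  show "affine_product (\<Union>k\<in>{1..r}. {Pos (out v k, g k)}) (\<Prod>k=1..r. edge_var (out v k) (g k))"
    by (rule affine_product_prod) (use inj in \<open>auto intro: affine_product_mvar dest: inj_onD\<close>)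
  have "out v k \<in> D" if "k \<in> {1..r}" for k
    using bij_betwE[OF bij_out[OF v]] that by (auto simp: out_edges_def)
  then show "(\<Union>k\<in>{1..r}. {Pos (out v k, g k)}) \<subseteq> fmc_vars X"
    using g edge_var_mem by blast
qed

text \<open>Here the flow is written out monomial by monomial: there are at most
  \<open>p ^ r\<close> of them, a constant, and each is a vertex axiom because its values sum to
  \<open>s\<close>, which is not 1 modulo \<open>p\<close>. Each costs its introduction and one
  addition.\<close>

lemma derive_vertex_flow:
  fixes \<Gamma> :: "('v tseitin_var fmc_var, 'a::field_char_0) mpoly set"
  assumes v: "v \<in> V" and s: "\<not> [s = 1] (mod int p)"
  shows "derives X Ax M \<Gamma> (2 * p ^ r) (flow p (out_edges {v}) s)"
proof -
  let ?T = "\<lambda>g. \<Prod>k=1..r. edge_var (out v k) (g k) :: ('v tseitin_var fmc_var, 'a) mpoly"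
  define F where "F = (PiE {1..r} (\<lambda>_. {..<p}) :: (nat \<Rightarrow> nat) set)"
  define I where "I = {g \<in> F. [int (\<Sum>k=1..r. g k) = s] (mod int p)}"
  have finF: "finite F" by (simp add: F_def finite_PiE)
  have cardI: "card I \<le> p ^ r"
  proof -
    have "card I \<le> card F" unfolding I_def using finF by (intro card_mono) auto
    then show ?thesis by (simp add: F_def card_PiE)
  qed
  have "edge_prod p (out_edges {v}) = (\<Prod>k=1..r. edge_poly p (out v k))"
    unfolding edge_prod_def by (rule prod.reindex_bij_betw[OF bij_out[OF v], symmetric])
  also have "\<dots> = (\<Sum>g\<in>F. monom (?T g) (\<Sum>k=1..r. g k))"
    by (simp add: edge_poly_def F_def prod_sum_PiE prod_monom)
  finally have "flow p (out_edges {v}) s =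
      (\<Sum>g\<in>F. if [int (\<Sum>k=1..r. g k) = s] (mod int p) then ?T g else 0)"
    by (simp only: flow_def residue_coeff_sum residue_coeff_monom)
  also have "\<dots> = (\<Sum>g\<in>I. ?T g)"
    unfolding I_def by (rule sum.inter_filter[OF finF, symmetric])
  finally have flow: "flow p (out_edges {v}) s = (\<Sum>g\<in>I. ?T g)" .
  have b: "sum_of_products 1 (fmc_vars X) (?T g)" if "g \<in> I" for g
    using that by (intro vertex_product_bound v) (auto simp: I_def F_def PiE_iff)
  have M: "1 \<le> M" "card I * 1 \<le> M"
    by (rule M_ge_linear, simp) (use cardI in \<open>simp add: M_def\<close>)
  have d: "derives X Ax M \<Gamma> 1 (?T g)" if g: "g \<in> I" for g
  proof (rule derives.init[OF init_vertex[OF v] sum_of_products_mono[OF b[OF g] M(1) subset_refl]])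
    show "\<forall>k\<in>{1..r}. g k < p" using g by (auto simp: I_def F_def PiE_iff)
    show "\<not> [(\<Sum>k = 1..r. g k) = 1] (mod p)"
    proof
      assume "[(\<Sum>k = 1..r. g k) = 1] (mod p)"
      then have "[int (\<Sum>k = 1..r. g k) = int 1] (mod int p)" by (simp only: cong_int_iff)
      moreover have "[int (\<Sum>k = 1..r. g k) = s] (mod int p)" using g by (simp add: I_def)
      ultimately have "[s = int 1] (mod int p)" using cong_sym cong_trans by blast
      then show False using s by simp
    qed
  qed
  have "finite I" using finF by (simp add: I_def)
  from derives_sum[OF this d b M(2)]
  have "derives X Ax M \<Gamma> (card I * (1 + 1)) (\<Sum>g\<in>I. ?T g)" .
  moreover have "card I * (1 + 1) \<le> 2 * p ^ r" using cardI by simp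
  ultimately show ?thesis unfolding flow by (rule derives.weaken)
qed

text \<open>As lines of a proof these say that the total over \<open>A\<close> can only be \<alpha>.
  The representatives below \<open>p\<close> suffice since flows are periodic in the residue, so
  there are at most \<open>p\<close> lines.\<close>

definition wrong_flows :: "('v \<times> 'v) set \<Rightarrow> int \<Rightarrow> ('v tseitin_var fmc_var, 'a::field_char_0) mpoly set" where
  "wrong_flows A \<alpha> = (\<lambda>s. flow p A s) ` {s \<in> {0..<int p}. \<not> [s = \<alpha>] (mod int p)}"

lemma wrong_flowsI: "\<not> [s = \<alpha>] (mod int p) \<Longrightarrow> flow p A s \<in> wrong_flows A \<alpha>"
proof -
  assume "\<not> [s = \<alpha>] (mod int p)"
  then have "\<not> [s mod int p = \<alpha>] (mod int p)" by simp
  moreover have "s mod int p \<in> {0..<int p}" using p_pos by simp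
  moreover have "flow p A s = (flow p A (s mod int p) :: ('v tseitin_var fmc_var, 'b::field_char_0) mpoly)"
    by (rule flow_cong) simp
  ultimately show ?thesis unfolding wrong_flows_def by blast
qed

lemma finite_wrong_flows: "finite (wrong_flows A \<alpha>)"
proof -
  have "finite {s \<in> {0..<int p}. \<not> [s = \<alpha>] (mod int p)}" by (rule finite_subset[of _ "{0..<int p}"]) auto
  then show ?thesis by (simp add: wrong_flows_def)
qed

lemma card_wrong_flows: "card (wrong_flows A \<alpha>) \<le> p"
proof -
  have "card {s \<in> {0..<int p}. \<not> [s = \<alpha>] (mod int p)} \<le> card {0..<int p}"
    by (rule card_mono) auto
  then have le: "card {s \<in> {0..<int p}. \<not> [s = \<alpha>] (mod int p)} \<le> p" by simp
  have "finite {s \<in> {0..<int p}. \<not> [s = \<alpha>] (mod int p)}" by (rule finite_subset[of _ "{0..<int p}"]) auto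
  then show ?thesis
    unfolding wrong_flows_def by (rule order_trans[OF card_image_le le])
qed

text \<open>In a term of the convolution, \<open>a\<close> congruent to \<alpha> and
  \<open>s - a\<close> congruent to 1 would make \<open>s\<close> congruent to
  \<open>\<alpha> + 1\<close>. So either the flow of the old edges is an available line or the flow
  at \<open>v\<close> follows from the axioms; multiplying by the other factor gives the
  term.\<close>

lemma derive_add_vertex:
  assumes v: "v \<in> V" and S: "S \<subseteq> V" "v \<notin> S" and s: "\<not> [s = \<alpha> + 1] (mod int p)"
  shows "derives X Ax M (wrong_flows (out_edges S) \<alpha> :: ('v tseitin_var fmc_var, 'a::field_char_0) mpoly set)
    (p * (2 * p ^ r + 2)) (flow p (out_edges (insert v S)) s)"
proof -
  let ?\<Gamma> = "wrong_flows (out_edges S) \<alpha> :: ('v tseitin_var fmc_var, 'a) mpoly set"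
  let ?A = "out_edges S" and ?C = "out_edges {v}"
  let ?f = "\<lambda>A s. flow p A s :: ('v tseitin_var fmc_var, 'a) mpoly"
  have AC: "?A \<subseteq> D" "?C \<subseteq> D" "?A \<inter> ?C = {}" using S(2) by (auto simp: out_edges_def)
  have fin: "finite ?A" "finite ?C" using AC finite_D finite_subset by blast+
  have disj: "edge_vars p ?A \<inter> edge_vars p ?C = {}" using AC(3) by (auto simp: edge_vars_def)
  have "out_edges (insert v S) = ?A \<union> ?C" by (auto simp: out_edges_def)
  then have flow: "?f (out_edges (insert v S)) s = (\<Sum>a<p. ?f ?A (int a) * ?f ?C (s - int a))"
    using flow_Un[OF fin AC(3) p_pos] by simp
  have b: "sum_of_products (B * B) (fmc_vars X) (?f ?A t * ?f ?C t')" for t t'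
    by (rule sum_of_products_mult_subset[OF flow_bound[OF AC(1)] flow_bound[OF AC(2)] disj])
      (simp_all add: edge_vars_subset AC)
  have M: "card {..<p} * (B * B) \<le> M" by (rule M_ge_BB) simp
  then have "B * B \<le> M" using p_pos by (cases p) simp_all
  note bM = sum_of_products_mono[OF b this subset_refl]
  have "derives X Ax M ?\<Gamma> (2 * p ^ r + 1) (?f ?A (int a) * ?f ?C (s - int a))" for a
  proof (cases "[int a = \<alpha>] (mod int p)")
    case True
    have "\<not> [s - int a = 1] (mod int p)"
    proof
      assume "[s - int a = 1] (mod int p)"
      from cong_add[OF this True] have "[s = \<alpha> + 1] (mod int p)" by (simp add: add.commute)
      with s show False ..
    qed
    from derives.product[OF derive_vertex_flow[OF v this] flow_vars[OF AC(1)] bM]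
    show ?thesis .
  next
    case False
    have "derives X Ax M ?\<Gamma> 0 (?f ?A (int a))"
      by (rule derives.line[OF wrong_flowsI[OF False]])
    from derives.product[OF this flow_vars[OF AC(2)], of "s - int a"] bM
    have "derives X Ax M ?\<Gamma> (0 + 1) (?f ?C (s - int a) * ?f ?A (int a))"
      by (simp add: mult.commute)
    then show ?thesis unfolding mult.commute[of "?f ?C (s - int a)"] by (rule derives.weaken) simp
  qed
  from derives_sum[OF finite_lessThan this b M]
  show ?thesis unfolding flow by (rule derives.weaken) simp
qed

section \<open>Assembling the refutation\<close>

lemma card_V_cong: "[int (card V) = 1] (mod int p)"
  using card_V cong_int_iff[of "card V" 1 p] by simp

lemma not_cong_0_1: "\<not> [0 = (1::int)] (mod int p)"
  using p_ge_2 by (auto simp: cong_def)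

text \<open>Vertices are added one at a time, each raising the expected total by 1. A vertex needs
  at most \<open>p\<close> new flows, each at the price given in
  \<open>derive_add_vertex\<close>.\<close>

lemma proof_of_vertex_flows:
  assumes "S \<subseteq> V"
  shows "\<exists>\<pi> :: ('v tseitin_var fmc_var, 'a::field_char_0) formula list. bounded_proof X Ax M \<pi> \<and>
    length \<pi> \<le> 2 + card S * (p * (p * (2 * p ^ r + 2))) \<and>
    insert 0 (wrong_flows (out_edges S) (int (card S))) \<subseteq> computes ` set \<pi>"
proof -
  have "finite S" using assms finite_V finite_subset by blast
  then show ?thesis using assms
  proof (induction S rule: finite_induct)
    case empty
    have "V \<noteq> {}" using card_V_cong not_cong_0_1 by auto
    then obtain v where v: "v \<in> V" by blast
    let ?P = "\<Prod>k=1..r. edge_var (out v k) 0 :: ('v tseitin_var fmc_var, 'a) mpoly"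
    have "\<not> [0 = (1::nat)] (mod p)" using p_ge_2 by (auto simp: cong_def)
    then have P: "?P \<in> Ax" using p_pos by (intro init_vertex v) auto
    have "1 \<le> M" by (rule M_ge_linear) simp
    then have b: "sum_of_products M (fmc_vars X) ?P"
      using p_pos by (intro sum_of_products_mono[OF vertex_product_bound[OF v]]) auto
    obtain \<pi>1 :: "('v tseitin_var fmc_var, 'a) formula list" where 1: "bounded_proof X Ax M \<pi>1"
      "length \<pi>1 = length ([] :: ('v tseitin_var fmc_var, 'a) formula list) + 1"
      "computes ` set \<pi>1 = insert ?P (computes ` set [])"
      by (rule bounded_proof_extend[OF bounded_proof_Nil finite_X b]) (use P in blast)
    have "0 = 0 * ?P" "mpoly_vars 0 \<subseteq> fmc_vars X" by simp_all
    then have just: "\<exists>R\<in>computes ` set \<pi>1. \<exists>q. mpoly_vars q \<subseteq> fmc_vars X \<and> 0 = q * R"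
      using 1(3) by blast
    obtain \<pi>2 where 2: "bounded_proof X Ax M \<pi>2" "length \<pi>2 = length \<pi>1 + 1"
      "computes ` set \<pi>2 = insert 0 (computes ` set \<pi>1)"
      by (rule bounded_proof_extend[OF 1(1) finite_X sum_of_products.zero]) (use just in blast)
    have "wrong_flows (out_edges {}) 0 \<subseteq> {0 :: ('v tseitin_var fmc_var, 'a) mpoly}"
      by (auto simp: wrong_flows_def out_edges_def flow_empty cong_sym_eq)
    then show ?case using 1(2) 2 by (intro exI[of _ \<pi>2]) auto
  next
    case (insert v S)
    then obtain \<pi>1 :: "('v tseitin_var fmc_var, 'a) formula list" where 1: "bounded_proof X Ax M \<pi>1"
      "length \<pi>1 \<le> 2 + card S * (p * (p * (2 * p ^ r + 2)))"
      "insert 0 (wrong_flows (out_edges S) (int (card S))) \<subseteq> computes ` set \<pi>1"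
      by blast
    let ?\<Delta> = "wrong_flows (out_edges (insert v S)) (int (card S) + 1)
      :: ('v tseitin_var fmc_var, 'a) mpoly set"
    have d: "derives X Ax M (wrong_flows (out_edges S) (int (card S))) (p * (2 * p ^ r + 2)) P"
      if P: "P \<in> ?\<Delta>" for P
    proof -
      obtain s where s: "\<not> [s = int (card S) + 1] (mod int p)"
        and P: "P = flow p (out_edges (insert v S)) s"
        using P unfolding wrong_flows_def by blast
      show ?thesis
        unfolding P using insert.prems insert.hyps(2) by (intro derive_add_vertex s) auto
    qed
    obtain \<pi>' where \<pi>': "bounded_proof X Ax M \<pi>'"
      "length \<pi>' \<le> length \<pi>1 + card ?\<Delta> * (p * (2 * p ^ r + 2))"
      "?\<Delta> \<union> computes ` set \<pi>1 \<subseteq> computes ` set \<pi>'"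
      using derives_set_bounded_proof[OF finite_wrong_flows d finite_X 1(1,3)] by blast
    have "card ?\<Delta> * (p * (2 * p ^ r + 2)) \<le> p * (p * (2 * p ^ r + 2))"
      using card_wrong_flows by (rule mult_le_mono1)
    moreover have "card (insert v S) * (p * (p * (2 * p ^ r + 2))) =
        p * (p * (2 * p ^ r + 2)) + card S * (p * (p * (2 * p ^ r + 2)))"
      using insert.hyps by simp
    ultimately have "length \<pi>' \<le> 2 + card (insert v S) * (p * (p * (2 * p ^ r + 2)))"
      using 1(2) \<pi>'(2) by linarith
    moreover have "insert 0 (wrong_flows (out_edges (insert v S)) (int (card (insert v S))))
        \<subseteq> computes ` set \<pi>'"
    proof -
      have "int (card (insert v S)) = int (card S) + 1" using insert.hyps by simp
      then show ?thesis using \<pi>'(3) 1(3) by auto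
    qed
    ultimately show ?case using \<pi>'(1) by blast
  qed
qed

text \<open>Opposite values cancel, so \<alpha> is the same throughout. The edge \<open>e\<close> is
  removed first and the induction hypothesis continues from the extended list, hence the list is
  arbitrary.\<close>

lemma proof_removing_edges:
  fixes \<pi> :: "('v tseitin_var fmc_var, 'a::field_char_0) formula list"
  assumes "finite F" "F \<subseteq> E" "bounded_proof X Ax M \<pi>"
    and "insert 0 (wrong_flows (directed_edges F) \<alpha>) \<subseteq> computes ` set \<pi>"
  shows "\<exists>\<pi>' :: ('v tseitin_var fmc_var, 'a) formula list. bounded_proof X Ax M \<pi>' \<and>
    length \<pi>' \<le> length \<pi> + card F * (p * (10 * p\<^sup>2 + 4 * p + 7)) \<and>
    wrong_flows {} \<alpha> \<subseteq> computes ` set \<pi>'"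
  using assms
proof (induction F arbitrary: \<pi> rule: finite_induct)
  case empty
  have "directed_edges ({} :: 'v set set) = {}" by (simp add: directed_edges_def)
  then show ?case using empty by (intro exI[of _ \<pi>]) auto
next
  case (insert e F)
  obtain u v where uv: "e = {u, v}" "u \<noteq> v"
    using insert.prems(1) simple by (auto simp: simple_graph_def)
  let ?A = "directed_edges F"
  have A: "?A \<subseteq> D" "(u, v) \<notin> ?A" "(v, u) \<notin> ?A" "(u, v) \<in> D"
    using insert.prems(1) insert.hyps(2) uv(1) by (auto simp: directed_edges_def insert_commute)
  have ins: "directed_edges (insert e F) = insert (u, v) (insert (v, u) ?A)"
    unfolding uv(1) by (auto simp: directed_edges_def doubleton_eq_iff)
  let ?\<Gamma> = "wrong_flows (directed_edges (insert e F)) \<alpha> :: ('v tseitin_var fmc_var, 'a) mpoly set"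
  let ?\<Delta> = "wrong_flows ?A \<alpha> :: ('v tseitin_var fmc_var, 'a) mpoly set"
  have d: "derives X Ax M ?\<Gamma> (10 * p\<^sup>2 + 4 * p + 7) P" if P: "P \<in> ?\<Delta>" for P
  proof -
    obtain s where s: "\<not> [s = \<alpha>] (mod int p)" and P: "P = flow p ?A s"
      using P unfolding wrong_flows_def by blast
    show ?thesis
      unfolding P
      by (rule derive_remove_edge_pair[OF A(1,4,2,3)]) (simp only: ins[symmetric] wrong_flowsI[OF s])
  qed
  obtain \<pi>1 where 1: "bounded_proof X Ax M \<pi>1"
    "length \<pi>1 \<le> length \<pi> + card ?\<Delta> * (10 * p\<^sup>2 + 4 * p + 7)"
    "?\<Delta> \<union> computes ` set \<pi> \<subseteq> computes ` set \<pi>1"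
    using derives_set_bounded_proof[OF finite_wrong_flows d finite_X insert.prems(2,3)] by blast
  have "insert 0 ?\<Delta> \<subseteq> computes ` set \<pi>1" using 1(3) insert.prems(3) by blast
  from insert.IH[OF _ 1(1) this] insert.prems(1) obtain \<pi>' :: "('v tseitin_var fmc_var, 'a) formula list"
    where \<pi>': "bounded_proof X Ax M \<pi>'"
    "length \<pi>' \<le> length \<pi>1 + card F * (p * (10 * p\<^sup>2 + 4 * p + 7))"
    "wrong_flows {} \<alpha> \<subseteq> computes ` set \<pi>'"
    by auto
  have "card ?\<Delta> * (10 * p\<^sup>2 + 4 * p + 7) \<le> p * (10 * p\<^sup>2 + 4 * p + 7)"
    using card_wrong_flows by (rule mult_le_mono1)
  moreover have "card (insert e F) * (p * (10 * p\<^sup>2 + 4 * p + 7)) =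
      p * (10 * p\<^sup>2 + 4 * p + 7) + card F * (p * (10 * p\<^sup>2 + 4 * p + 7))"
    using insert.hyps by simp
  ultimately have "length \<pi>' \<le> length \<pi> + card (insert e F) * (p * (10 * p\<^sup>2 + 4 * p + 7))"
    using 1(2) \<pi>'(2) by linarith
  then show ?case using \<pi>'(1,3) by blast
qed

lemma edges_image: "E \<subseteq> (\<lambda>(u, v). {u, v}) ` D"
proof
  fix e assume e: "e \<in> E"
  then obtain u v where "e = {u, v}" using simple by (auto simp: simple_graph_def)
  with e show "e \<in> (\<lambda>(u, v). {u, v}) ` D"
    by (intro image_eqI[of _ _ "(u, v)"]) (auto simp: directed_edges_def)
qed

lemma finite_E: "finite E"
  using edges_image finite_D by (rule finite_surj[rotated])

lemma card_E: "card E \<le> card V * r"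
  using surj_card_le[OF finite_D edges_image] by (simp add: card_D)

lemma refutation:
  obtains \<pi> :: "('v tseitin_var fmc_var, 'a::field_char_0) formula list"
  where "depth_fmc_refutation 3 X Ax \<pi>"
    and "proof_size \<pi> \<le> (2 + card V * (p * (p * (2 * p ^ r + 2)))
        + card V * r * (p * (10 * p\<^sup>2 + 4 * p + 7))) * (2 + M * (2 + 3 * (2 * (card V * r * p))))"
proof -
  obtain \<pi>1 :: "('v tseitin_var fmc_var, 'a) formula list" where 1: "bounded_proof X Ax M \<pi>1"
    "length \<pi>1 \<le> 2 + card V * (p * (p * (2 * p ^ r + 2)))"
    "insert 0 (wrong_flows (out_edges V) (int (card V))) \<subseteq> computes ` set \<pi>1"
    using proof_of_vertex_flows[OF order_refl] by blast
  have "out_edges V = D" using D_subset by (auto simp: out_edges_def)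
  then have "insert 0 (wrong_flows D (int (card V))) \<subseteq> computes ` set \<pi>1"
    using 1(3) by simp
  from proof_removing_edges[OF finite_E order_refl 1(1) this]
  obtain \<pi>2 :: "('v tseitin_var fmc_var, 'a) formula list" where 2: "bounded_proof X Ax M \<pi>2"
    "length \<pi>2 \<le> length \<pi>1 + card E * (p * (10 * p\<^sup>2 + 4 * p + 7))"
    "wrong_flows {} (int (card V)) \<subseteq> computes ` set \<pi>2"
    by blast
  have "\<not> [0 = int (card V)] (mod int p)"
    using card_V_cong not_cong_0_1 cong_trans by blast
  then have "flow p {} 0 \<in> computes ` set \<pi>2"
    using wrong_flowsI 2(3) by blast
  then have one: "1 \<in> computes ` set \<pi>2" by (simp add: flow_empty)
  obtain \<pi>' :: "('v tseitin_var fmc_var, 'a) formula list"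
    where \<pi>': "depth_fmc_refutation 3 X Ax \<pi>'"
    "proof_size \<pi>' \<le> length \<pi>2 * (2 + M * (2 + 3 * card (fmc_vars X)))"
    by (rule bounded_proof_refutation[OF 2(1) one])
  have "card E * (p * (10 * p\<^sup>2 + 4 * p + 7)) \<le> card V * r * (p * (10 * p\<^sup>2 + 4 * p + 7))"
    using card_E by (rule mult_le_mono1)
  then have "length \<pi>2 \<le> 2 + card V * (p * (p * (2 * p ^ r + 2)))
      + card V * r * (p * (10 * p\<^sup>2 + 4 * p + 7))"
    using 1(2) 2(2) by linarith
  moreover have "2 + M * (2 + 3 * card (fmc_vars X)) \<le> 2 + M * (2 + 3 * (2 * (card V * r * p)))"
    using card_fmc_vars by (intro add_left_mono mult_le_mono2) simp
  ultimately show thesis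
    using \<pi>' by (intro that[OF \<pi>'(1)] order_trans[OF \<pi>'(2)] mult_le_mono)
qed

end

theorem theorem9p17:
  fixes p r :: nat
  assumes "p \<ge> 2"
  shows "\<exists>b :: nat poly. \<forall>(V :: 'v set) (E :: 'v set set) (out :: 'v \<Rightarrow> nat \<Rightarrow> 'v \<times> 'v).
           simple_graph V E \<and> connected_graph V E \<and> regular_graph V E r \<and>
           [card V = 1] (mod p) \<and> out_enumeration V E r out \<longrightarrow>
           (\<exists>\<pi> :: ('v tseitin_var fmc_var, 'a::field_char_0) formula list.
              depth_fmc_refutation 3 (tseitin_vars E p) (translate ` neg_tseitin V E p r out) \<pi> \<and>
              proof_size \<pi> \<le> poly b (card V))"
proof -
  \<comment> \<open>The bound of \<open>refutation\<close> as a polynomial in \<open>card V\<close>: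
    the number of lines, the bound \<open>M\<close> with \<open>[:1, r * p:]\<close> for
    \<open>B\<close>, and the nodes per product. Its degree is at most 4, and its coefficients
    depend only on \<open>p\<close> and \<open>r\<close>.\<close>
  let ?length = "[:2:] + [:0, p * (p * (2 * p ^ r + 2)):] + [:0, r * (p * (10 * p\<^sup>2 + 4 * p + 7)):]"
  let ?M = "[:p ^ r:] + [:4 * p\<^sup>2:] * [:1, r * p:] ^ 2"
  let ?b = "?length * ([:2:] + ?M * [:2, 3 * (2 * (r * p)):])"
  show ?thesis
  proof (intro exI[of _ ?b] allI impI)
    fix V :: "'v set" and E :: "'v set set" and out :: "'v \<Rightarrow> nat \<Rightarrow> 'v \<times> 'v"
    assume "simple_graph V E \<and> connected_graph V E \<and> regular_graph V E r \<and>
        [card V = 1] (mod p) \<and> out_enumeration V E r out"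
    then interpret tseitin_instance V E p r out
      using assms by unfold_locales auto
    obtain \<pi> :: "('v tseitin_var fmc_var, 'a) formula list"
      where \<pi>: "depth_fmc_refutation 3 X Ax \<pi>"
        "proof_size \<pi> \<le> (2 + card V * (p * (p * (2 * p ^ r + 2)))
          + card V * r * (p * (10 * p\<^sup>2 + 4 * p + 7))) * (2 + M * (2 + 3 * (2 * (card V * r * p))))"
      by (rule refutation)
    have "poly ?length (card V) = 2 + card V * (p * (p * (2 * p ^ r + 2)))
        + card V * r * (p * (10 * p\<^sup>2 + 4 * p + 7))"
      by (simp add: algebra_simps)
    moreover have "poly ?M (card V) = M"
      by (simp add: M_def B_def mult.assoc)
    ultimately have "proof_size \<pi> \<le> poly ?b (card V)"
      using \<pi>(2) by (simp only: poly_mult poly_add) (simp add: mult.assoc mult.left_commute)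
    with \<pi>(1) show "\<exists>\<pi> :: ('v tseitin_var fmc_var, 'a) formula list.
        depth_fmc_refutation 3 (tseitin_vars E p) (translate ` neg_tseitin V E p r out) \<pi> \<and>
        proof_size \<pi> \<le> poly ?b (card V)"
      by blast
  qed
qed

end
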